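(* Let $h$ be an S-shaped (SS) distortion function with an inflection point $p\in(0,1)$, and let $C$ be a copula. Consider the statements: (i) $C=C^\pm_p$ and $h'(p^+)\le h'(0^+)$; (ii) $C$ is universally maximal for $h$. Then (i) implies (ii). If $h$ is strictly SS (with inflection point $p$), then (i) and (ii) are equivalent.
   Context: Fix an atomless probability space $(\Omega,\mathcal A,\mathbb P)$ and let $\mathcal X$ be the set of bounded random variables on it. $X\overset{\mathrm d}{=}X'$ means equality in law. A distortion function is an increasing (non-strictly) function $h:[0,1]\to[0,1]$ with $h(0)=0$ and $h(1)=1$. The associated distorted expectation $\mathcal E^h:\mathcal X\to\mathbb R$ is $$\mathcal E^h[X]=\int_0^\infty h(\mathbb P(X>x))\,\mathrm dx+\int_{-\infty}^0\big(h(\mathbb P(X>x))-1\big)\,\mathrm dx.$$ A distortion function $h$ is S-shaped (SS) with inflection point $p\in(0,1)$ if it is continuous, convex on $(0,p)$ and concave on $(p,1)$; it is strictly SS if it is moreover strictly convex on $(0,p)$ and strictly concave on $(p,1)$. $h'(t^+)$ denotes the right derivative of $h$ at $t\in[0,1)$ (it exists for SS $h$, possibly infinite). A copula is a distribution function on $[0,1]^2$ with uniform $[0,1]$ marginals. $C$ is a copula of $(X,Y)$ if $\mathbb P(X\le x,Y\le y)=C(\mathbb P(X\le x),\mathbb P(Y\le y))$ for all $x,y\in\mathbb R$. For $p\in(0,1)$, the copula $C^\pm_p$ is given, for $u,v\in[0,1]$, by $C^\pm_p(u,v)=\min\{u,v\}$ if $\min\{u,v\}\in[0,1-p]$, and $C^\pm_p(u,v)=\max\{u+v-1,1-p\}$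 otherwise. A copula $C$ is universally maximal for $h$ (with linear cost $c(x,y)=x+y$) if for all $X,Y\in\mathcal X$ such that $C$ is a copula of $(X,Y)$, $\mathcal E^h[X+Y]\ge\mathcal E^h[X'+Y']$ for all $X',Y'\in\mathcal X$ with $X'\overset{\mathrm d}{=}X$ and $Y'\overset{\mathrm d}{=}Y$. *)

theory Defs
  imports "HOL-Probability.Probability"
begin

definition atomless :: "'a measure \<Rightarrow> bool" where
  "atomless M \<longleftrightarrow>
     (\<forall>A\<in>sets M. emeasure M A > 0 \<longrightarrow>
        (\<exists>B\<in>sets M. B \<subseteq> A \<and> 0 < emeasure M B \<and> emeasure M B < emeasure M A))"

text \<open>Boundedness is pointwise on the sample space, not merely almost sure.\<close>

definition bounded_rvs :: "'a measure \<Rightarrow> ('a \<Rightarrow> real) set" where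
  "bounded_rvs M = {X \<in> borel_measurable M. bounded (X ` space M)}"

definition eq_in_law :: "'a measure \<Rightarrow> ('a \<Rightarrow> real) \<Rightarrow> ('a \<Rightarrow> real) \<Rightarrow> bool" where
  "eq_in_law M X X' \<longleftrightarrow> distr M borel X = distr M borel X'"

text \<open>Functions on the unit interval or the unit square are represented by total functions on
  the reals; every definition below depends only on their values on that domain.\<close>

definition distortion_function :: "(real \<Rightarrow> real) \<Rightarrow> bool" where
  "distortion_function h \<longleftrightarrow>
     h \<in> {0..1} \<rightarrow> {0..1} \<and> mono_on {0..1} h \<and> h 0 = 0 \<and> h 1 = 1"

definition distorted_expectation :: "'a measure \<Rightarrow> (real \<Rightarrow> real) \<Rightarrow> ('a \<Rightarrow> real) \<Rightarrow> real" where
  "distorted_expectation M h X =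
     (LBINT x:{0..}. h (measure M {\<omega> \<in> space M. X \<omega> > x})) +
     (LBINT x:{..0}. (h (measure M {\<omega> \<in> space M. X \<omega> > x}) - 1))"

definition strictly_convex_on :: "real set \<Rightarrow> (real \<Rightarrow> real) \<Rightarrow> bool" where
  "strictly_convex_on S f \<longleftrightarrow>
     convex S \<and>
     (\<forall>x\<in>S. \<forall>y\<in>S. \<forall>u>0. \<forall>v>0. x \<noteq> y \<longrightarrow> u + v = 1 \<longrightarrow>
        f (u * x + v * y) < u * f x + v * f y)"

definition strictly_concave_on :: "real set \<Rightarrow> (real \<Rightarrow> real) \<Rightarrow> bool" where
  "strictly_concave_on S f \<longleftrightarrow> strictly_convex_on S (\<lambda>x. - f x)"

definition S_shaped :: "(real \<Rightarrow> real) \<Rightarrow> real \<Rightarrow> bool" where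
  "S_shaped h p \<longleftrightarrow>
     distortion_function h \<and> p \<in> {0<..<1} \<and> continuous_on {0..1} h \<and>
     convex_on {0<..<p} h \<and> concave_on {p<..<1} h"

definition strictly_S_shaped :: "(real \<Rightarrow> real) \<Rightarrow> real \<Rightarrow> bool" where
  "strictly_S_shaped h p \<longleftrightarrow>
     S_shaped h p \<and> strictly_convex_on {0<..<p} h \<and> strictly_concave_on {p<..<1} h"

text \<open>Extended-real-valued, because an S-shaped function can have an infinite right derivative
  at its inflection point.\<close>

definition right_deriv :: "(real \<Rightarrow> real) \<Rightarrow> real \<Rightarrow> ereal" where
  "right_deriv h t = Lim (at_right t) (\<lambda>s. ereal ((h s - h t) / (s - t)))"

definition is_copula :: "(real \<Rightarrow> real \<Rightarrow> real) \<Rightarrow> bool" where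
  "is_copula C \<longleftrightarrow>
     (\<exists>\<mu> :: (real \<times> real) measure.
        prob_space \<mu> \<and> sets \<mu> = sets borel \<and>
        distr \<mu> borel fst = uniform_measure lborel {0..1} \<and>
        distr \<mu> borel snd = uniform_measure lborel {0..1} \<and>
        (\<forall>u\<in>{0..1}. \<forall>v\<in>{0..1}. C u v = measure \<mu> ({..u} \<times> {..v})))"

definition copula_of ::
    "'a measure \<Rightarrow> (real \<Rightarrow> real \<Rightarrow> real) \<Rightarrow> ('a \<Rightarrow> real) \<Rightarrow> ('a \<Rightarrow> real) \<Rightarrow> bool" where
  "copula_of M C X Y \<longleftrightarrow>
     (\<forall>x y. measure M {\<omega> \<in> space M. X \<omega> \<le> x \<and> Y \<omega> \<le> y} =
        C (measure M {\<omega> \<in> space M. X \<omega> \<le> x}) (measure M {\<omega> \<in> space M. Y \<omega> \<le> y}))"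

definition C_pm :: "real \<Rightarrow> real \<Rightarrow> real \<Rightarrow> real" where
  "C_pm p u v = (if min u v \<in> {0..1 - p} then min u v else max (u + v - 1) (1 - p))"

definition universally_maximal ::
    "'a measure \<Rightarrow> (real \<Rightarrow> real) \<Rightarrow> (real \<Rightarrow> real \<Rightarrow> real) \<Rightarrow> bool" where
  "universally_maximal M h C \<longleftrightarrow>
     (\<forall>X\<in>bounded_rvs M. \<forall>Y\<in>bounded_rvs M. copula_of M C X Y \<longrightarrow>
        (\<forall>X'\<in>bounded_rvs M. \<forall>Y'\<in>bounded_rvs M.
           eq_in_law M X' X \<longrightarrow> eq_in_law M Y' Y \<longrightarrow>
           distorted_expectation M h (\<lambda>\<omega>. X \<omega> + Y \<omega>)
             \<ge> distorted_expectation M h (\<lambda>\<omega>. X' \<omega> + Y' \<omega>)))"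

end

theory Submission
  imports Defs
begin

text \<open>
  Write \<open>S\<^sub>Z x = P(Z > x)\<close>. The distorted expectation is linear in \<open>h\<close>. Condition (i) says that some
  number \<open>d\<close> separates the slopes of \<open>h\<close> on \<open>(p, 1)\<close>, which are at most \<open>d\<close>, from those on \<open>(0, p)\<close>,
  which are at least \<open>d\<close>. Hence \<open>h\<close> is a uniform limit of nonnegative combinations of
  \<open>t \<mapsto> min t \<alpha>\<close> with \<open>\<alpha> \<ge> p\<close> and of \<open>t \<mapsto> min t p - min t a\<close> with \<open>a \<le> p\<close>, so it suffices to treat the
  tail means \<open>T \<alpha> Z = \<integral> (min (S\<^sub>Z x) \<alpha> - \<alpha> 1\<^bsub>x<0\<^esub>) dx\<close> for \<open>\<alpha> \<ge> p\<close> and the differences \<open>T p - T a\<close>. Now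
  \<open>T \<alpha> Z\<close> is the minimum over \<open>k\<close> of \<open>\<alpha> k + E (Z - k)\<^sup>+\<close>, and \<open>E (X + Y - k)\<^sup>+ = \<integral> P(X > s, Y > k - s) ds\<close>
  is determined by the copula, so every claim about \<open>X + Y\<close> becomes a pointwise inequality between
  integrands; no coupling by quantile functions is needed.

  Conversely, for indicators of events with probabilities \<open>\<alpha>\<close> and \<open>\<beta>\<close>, maximality says that the
  probability of the intersection maximises \<open>\<gamma> \<mapsto> h \<gamma> + h (\<alpha> + \<beta> - \<gamma>)\<close>. On the diagonal, strict concavity
  and the intermediate value theorem force \<open>C u u = u\<close> for \<open>u \<le> 1 - p\<close>; the case \<open>\<alpha> = p\<close> then
  gives the condition on the derivatives, which in turn determines the maximiser for \<open>\<alpha>, \<beta> \<le> p\<close>.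
\<close>

section \<open>Convex functions\<close>

lemma at_right_comp_continuous:
  fixes f g :: "real \<Rightarrow> real"
  assumes "continuous_on S f" "continuous_on {0..c} g" "g ` {0..c} \<subseteq> S" "0 < c"
  shows "((\<lambda>e. f (g e)) \<longlongrightarrow> f (g 0)) (at_right 0)"
proof -
  have "continuous_on {0..c} (\<lambda>e. f (g e))"
    using continuous_on_compose2[OF assms(1,2,3)] .
  then have "((\<lambda>e. f (g e)) \<longlongrightarrow> f (g 0)) (at 0 within {0..c})"
    using \<open>0 < c\<close> by (auto simp: continuous_on)
  then show ?thesis using at_within_Icc_at_right[OF \<open>0 < c\<close>] by simp
qed

text \<open>Shrinking a segment by \<open>e\<close> at both ends moves it into the open interval;
  the inequality there passes to the limit by continuity. \<open>S_shaped\<close> gives convexity on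
  open intervals only, whereas the chords used later start at 0 and at \<open>p\<close>.\<close>

lemma convex_on_Icc_if_convex_on_Ioo:
  fixes f :: "real \<Rightarrow> real"
  assumes cont: "continuous_on {a..b} f" and conv: "convex_on {a<..<b} f"
  shows "convex_on {a..b} f"
proof (rule convex_on_linorderI)
  fix t x y :: real
  assume t: "0 < t" "t < 1" and xy: "x \<in> {a..b}" "y \<in> {a..b}" "x < y"
  define c where "c = (y - x) / 3"
  have c: "0 < c" "2 * c < y - x" using xy by (auto simp: c_def)
  have mem: "(1 - t) * (x + e) + t * (y - e) \<in> {a..b}"
    if "e \<in> {0..c}" for e
    using convexD_alt[of "{a..b}" "x + e" "y - e" t] that xy c t by (auto simp: algebra_simps)
  have l1: "((\<lambda>e. f ((1 - t) * (x + e) + t * (y - e))) \<longlongrightarrow> f ((1 - t) * (x + 0) + t * (y - 0))) (at_right 0)"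
    using mem by (intro at_right_comp_continuous[OF cont _ _ c(1)] continuous_intros) auto
  have l2: "((\<lambda>e. f (x + e)) \<longlongrightarrow> f (x + 0)) (at_right 0)"
    using xy c by (intro at_right_comp_continuous[OF cont _ _ c(1)] continuous_intros) auto
  have l3: "((\<lambda>e. f (y - e)) \<longlongrightarrow> f (y - 0)) (at_right 0)"
    using xy c by (intro at_right_comp_continuous[OF cont _ _ c(1)] continuous_intros) auto
  have ev: "\<forall>\<^sub>F e in at_right 0. f ((1 - t) * (x + e) + t * (y - e))
              \<le> (1 - t) * f (x + e) + t * f (y - e)"
  proof (rule eventually_at_right_less[of 0, THEN eventually_rev_mp],
         rule eventually_mono[OF eventually_at_right_real[OF c(1)]], intro impI)
    fix e assume "e \<in> {0<..<c}" "0 < e"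
    then show "f ((1 - t) * (x + e) + t * (y - e)) \<le> (1 - t) * f (x + e) + t * f (y - e)"
      using convex_onD[OF conv, of t "x + e" "y - e"] t xy c by auto
  qed
  have "f ((1 - t) * (x + 0) + t * (y - 0)) \<le> (1 - t) * f (x + 0) + t * f (y - 0)"
    by (rule tendsto_le[OF _ _ l1 ev]) (auto intro!: tendsto_intros l2[simplified] l3[simplified])
  then show "f ((1 - t) *\<^sub>R x + t *\<^sub>R y) \<le> (1 - t) * f x + t * f y" by simp
qed simp

text \<open>\<open>y\<close> and \<open>z\<close> are convex combinations of \<open>x\<close> and
  \<open>w\<close> with the weights interchanged, so the two convexity inequalities add up to weight
  1 at each end. Most later uses of convexity have this form: at equal sums, the more widely spread
  pair has the larger total.\<close>

lemma convex_on_exchange: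
  fixes f :: "real \<Rightarrow> real"
  assumes f: "convex_on S f" and S: "x \<in> S" "w \<in> S" and "x \<le> y" "y \<le> w" "y + z = x + w"
  shows "f y + f z \<le> f x + f w"
proof (cases "x = w")
  case False
  define t where "t = (y - x) / (w - x)"
  have t: "0 \<le> t" "t \<le> 1" using assms False by (auto simp: t_def divide_simps)
  have "t * (w - x) = y - x" using False by (simp add: t_def)
  then have y: "y = (1 - t) * x + t * w" and z: "z = t * x + (1 - t) * w"
    using assms(6) by (simp_all add: algebra_simps)
  have "f y \<le> (1 - t) * f x + t * f w"
    using convex_onD[OF f t S] y by simp
  moreover have "f z \<le> t * f x + (1 - t) * f w"
    using convex_onD[OF f _ _ S, of "1 - t"] t z by simp
  ultimately show ?thesis by (simp add: algebra_simps)
qed (use assms in auto)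

lemma strictly_convex_on_imp_convex_on:
  "strictly_convex_on S f \<Longrightarrow> convex_on S f"
proof (rule convex_onI)
  fix t x y :: real
  assume *: "strictly_convex_on S f" "0 < t" "t < 1" "x \<in> S" "y \<in> S"
  show "f ((1 - t) *\<^sub>R x + t *\<^sub>R y) \<le> (1 - t) * f x + t * f y"
  proof (cases "x = y")
    case True
    then show ?thesis by (simp add: algebra_simps)
  next
    case False
    then have "f ((1 - t) * x + t * y) < (1 - t) * f x + t * f y"
      using * unfolding strictly_convex_on_def by (meson add.commute diff_add_cancel diff_gt_0_iff_gt)
    then show ?thesis by simp
  qed
qed (simp add: strictly_convex_on_def)

lemma strictly_convex_on_exchange_Ioo:
  assumes f: "strictly_convex_on S f" and S: "x \<in> S" "w \<in> S"
    and "x < y" "y < w" "y + z = x + w"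
  shows "f y + f z < f x + f w"
proof -
  define t where "t = (y - x) / (w - x)"
  have t: "0 < t" "t < 1" using assms by (auto simp: t_def divide_simps)
  have "t * (w - x) = y - x" using assms by (simp add: t_def)
  then have y: "y = (1 - t) * x + t * w" and z: "z = t * x + (1 - t) * w"
    using assms(6) by (simp_all add: algebra_simps)
  have "x \<noteq> w" using assms by simp
  have *: "f (u * x + v * w) < u * f x + v * f w" if "u > 0" "v > 0" "u + v = 1" for u v
    using f S \<open>x \<noteq> w\<close> that unfolding strictly_convex_on_def by blast
  have "f y < (1 - t) * f x + t * f w" "f z < t * f x + (1 - t) * f w"
    unfolding y z using t by (intro *; simp)+
  then show ?thesis by (simp add: algebra_simps)
qed

text \<open>Strictness is available in the open interval only, so the outer pair is first moved
  inwards by \<open>e\<close>; the strict inequality applies there, and the weak one on the closed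
  interval leads back to \<open>x\<close> and \<open>w\<close>.\<close>

lemma strictly_convex_on_exchange:
  assumes cont: "continuous_on {a..b} f" and f: "strictly_convex_on {a<..<b} f"
    and S: "x \<in> {a..b}" "w \<in> {a..b}" and "x < y" "y < w" "y + z = x + w"
  shows "f y + f z < f x + f w"
proof -
  have conv: "convex_on {a..b} f"
    using convex_on_Icc_if_convex_on_Ioo[OF cont strictly_convex_on_imp_convex_on[OF f]] .
  define e where "e = min (y - x) (w - y) / 2"
  have e: "0 < e" "e < y - x" "e < w - y" using assms by (auto simp: e_def min_def)
  have "f y + f z < f (x + e) + f (w - e)"
    using assms e by (intro strictly_convex_on_exchange_Ioo[OF f]) auto
  also have "\<dots> \<le> f x + f w"
    using assms e by (intro convex_on_exchange[OF conv]) auto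
  finally show ?thesis .
qed

section \<open>One-sided derivatives as extremal chord slopes\<close>

lemma tendsto_at_right_INF:
  fixes f :: "real \<Rightarrow> ereal"
  assumes "a < b" and mono: "\<And>s t. a < s \<Longrightarrow> s \<le> t \<Longrightarrow> t \<le> b \<Longrightarrow> f s \<le> f t"
  shows "(f \<longlongrightarrow> (INF s\<in>{a<..b}. f s)) (at_right a)"
proof (rule order_tendstoI)
  fix l assume "l < (INF s\<in>{a<..b}. f s)"
  then have "l < f s" if "s \<in> {a<..b}" for s
    using INF_lower[OF that, of f] by (rule less_le_trans)
  then show "\<forall>\<^sub>F s in at_right a. l < f s"
    using eventually_at_right_real[OF \<open>a < b\<close>] by (auto elim: eventually_mono)
next
  fix u assume "(INF s\<in>{a<..b}. f s) < u"
  then obtain s where s: "s \<in> {a<..b}" "f s < u" unfolding INF_less_iff by blast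
  have "f r < u" if "r \<in> {a<..<s}" for r
    using le_less_trans[OF mono[of r s] s(2)] that s by auto
  then show "\<forall>\<^sub>F s in at_right a. f s < u"
    using eventually_at_right_real[of a s] s by (auto elim: eventually_mono)
qed

lemma tendsto_at_right_SUP:
  fixes f :: "real \<Rightarrow> ereal"
  assumes "a < b" and mono: "\<And>s t. a < s \<Longrightarrow> s \<le> t \<Longrightarrow> t \<le> b \<Longrightarrow> f t \<le> f s"
  shows "(f \<longlongrightarrow> (SUP s\<in>{a<..b}. f s)) (at_right a)"
proof -
  have "((\<lambda>s. - f s) \<longlongrightarrow> (INF s\<in>{a<..b}. - f s)) (at_right a)"
    using assms by (intro tendsto_at_right_INF) auto
  then have "((\<lambda>s. - (- f s)) \<longlongrightarrow> - (INF s\<in>{a<..b}. - f s)) (at_right a)"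
    by (rule tendsto_uminus_ereal)
  then show ?thesis by (simp add: ereal_INF_uminus_eq)
qed

lemma convex_on_slope_mono:
  fixes f :: "real \<Rightarrow> real"
  assumes "convex_on {a..b} f" "a < s" "s \<le> t" "t \<le> b"
  shows "(f s - f a) / (s - a) \<le> (f t - f a) / (t - a)"
proof (cases "s = t")
  case False
  then have "(f a - f s) / (a - s) \<le> (f a - f t) / (a - t)"
    using assms by (intro convex_on_slope_le(1)[OF assms(1)]) auto
  then show ?thesis by (metis minus_diff_eq minus_divide_divide)
qed auto

text \<open>The chord slopes from \<open>a\<close> increase with the other endpoint, so they
  converge in the extended reals to their infimum; in particular \<open>Lim\<close> denotes a
  genuine limit here.\<close>

lemma right_deriv_convex:
  assumes "convex_on {a..b} f" "a < b"
  shows "right_deriv f a = (INF s\<in>{a<..b}. ereal ((f s - f a) / (s - a)))"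
  unfolding right_deriv_def
  by (intro tendsto_Lim tendsto_at_right_INF assms)
    (use convex_on_slope_mono[OF assms(1)] in auto)

lemma right_deriv_concave:
  assumes "concave_on {a..b} f" "a < b"
  shows "right_deriv f a = (SUP s\<in>{a<..b}. ereal ((f s - f a) / (s - a)))"
proof -
  have "(f t - f a) / (t - a) \<le> (f s - f a) / (s - a)" if "a < s" "s \<le> t" "t \<le> b" for s t
    using convex_on_slope_mono[of a b "\<lambda>x. - f x" s t] assms that
    by (simp add: concave_on_def diff_divide_distrib)
  then show ?thesis
    unfolding right_deriv_def by (intro tendsto_Lim tendsto_at_right_SUP assms) auto
qed

lemma SUP_ereal_le_INF_ereal_iff:
  "(SUP s\<in>A. ereal (f s)) \<le> (INF t\<in>B. ereal (g t)) \<longleftrightarrow> (\<forall>s\<in>A. \<forall>t\<in>B. f s \<le> g t)"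
  by (auto simp: SUP_le_iff le_INF_iff)

section \<open>Uniform approximation by ramps and capped linear functions\<close>

text \<open>Passing the knot \<open>x (Suc j)\<close> changes the slope from \<open>m j\<close> to
  \<open>m (Suc j)\<close>. When \<open>m\<close> lists the chord slopes of \<open>g\<close>, the
  sum is the piecewise linear interpolant of \<open>g\<close> on the cell starting at
  \<open>x j\<close>, up to the constant \<open>g (x 0)\<close>.\<close>

lemma sum_ramps_at:
  fixes x m :: "nat \<Rightarrow> real" and g :: "real \<Rightarrow> real"
  assumes "\<And>k. k < j \<Longrightarrow> m k * (x (Suc k) - x k) = g (x (Suc k)) - g (x k)"
  shows "(\<Sum>k\<le>j. (m k - (if k = 0 then 0 else m (k - 1))) * (t - x k))
           = g (x j) - g (x 0) + m j * (t - x j)"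
  using assms
proof (induction j)
  case (Suc j)
  have "(\<Sum>k\<le>Suc j. (m k - (if k = 0 then 0 else m (k - 1))) * (t - x k))
     = g (x j) - g (x 0) + m j * (t - x j) + (m (Suc j) - m j) * (t - x (Suc j))"
    using Suc by simp
  also have "\<dots> = g (x j) - g (x 0) + m j * (x (Suc j) - x j) + m (Suc j) * (t - x (Suc j))"
    by (simp add: algebra_simps)
  finally show ?case using Suc.prems[of j] by simp
qed simp

text \<open>Linear interpolation on a uniform grid. The coefficients are the increments of the chord
  slopes, nonnegative by convexity, the first one by monotonicity. Their sum telescopes to the last
  chord slope, whence the third conclusion; it later makes the coefficient \<open>r\<close> in
  \<open>S_shaped_approx\<close> nonnegative.\<close>

lemma convex_approx_ramps:
  fixes g :: "real \<Rightarrow> real"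
  assumes conv: "convex_on {0..q} g" and cont: "continuous_on {0..q} g"
    and mono: "mono_on {0..q} g" and "0 < q" "0 < \<epsilon>"
  obtains n :: nat and c a :: "nat \<Rightarrow> real"
  where "\<And>k. k < n \<Longrightarrow> 0 \<le> c k" "\<And>k. k < n \<Longrightarrow> a k \<in> {0..<q}"
    "\<And>D. (\<And>s t. 0 \<le> s \<Longrightarrow> s \<le> t \<Longrightarrow> t \<le> q \<Longrightarrow> g t - g s \<le> D * (t - s)) \<Longrightarrow> (\<Sum>k<n. c k) \<le> D"
    "\<And>t. t \<in> {0..q} \<Longrightarrow> \<bar>g t - g 0 - (\<Sum>k<n. c k * max 0 (t - a k))\<bar> \<le> \<epsilon>"
proof -
  obtain \<delta> where \<delta>: "\<delta> > 0"
    "\<And>s t. s \<in> {0..q} \<Longrightarrow> t \<in> {0..q} \<Longrightarrow> dist t s < \<delta> \<Longrightarrow> dist (g t) (g s) < \<epsilon>"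
    using compact_uniformly_continuous[OF cont] \<open>0 < \<epsilon>\<close> unfolding uniformly_continuous_on_def by auto
  obtain n0 :: nat where "q / \<delta> < real n0" using reals_Archimedean2 by blast
  \<comment> \<open>The mesh \<open>q / n\<close> falls below the modulus of continuity
    \<open>\<delta>\<close>, and \<open>n0\<close> is the index of the last cell.\<close>
  define n where "n = Suc n0"
  define w where "w = q / real n"
  have w: "0 < w" "w < \<delta>" "real n * w = q"
    using \<open>q / \<delta> < real n0\<close> \<open>0 < q\<close> \<delta>(1) by (auto simp: w_def n_def divide_simps algebra_simps)
  define x where "x k = real k * w" for k :: nat
  define m where "m k = (g (x (Suc k)) - g (x k)) / w" for k
  define c where "c k = m k - (if k = 0 then 0 else m (k - 1))" for k
  have x_Suc: "x (Suc k) = x k + w" for k by (simp add: x_def algebra_simps)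
  have x0: "x 0 = 0" by (simp add: x_def)
  have x_le: "x k \<le> x l" if "k \<le> l" for k l
    using that w(1) by (simp add: x_def)
  have xn: "x n = q" using w by (simp add: x_def)
  have x_in: "x k \<in> {0..q}" if "k \<le> n" for k
    using x_le[OF that] x_le[of 0 k] x0 xn by simp
  have m0: "0 \<le> m k" if "k < n" for k
    using mono_onD[OF mono x_in[of k] x_in[of "Suc k"]] x_le[of k "Suc k"] that w(1)
    by (simp add: m_def)
  have c0: "0 \<le> c k" if k: "k < n" for k
  proof (cases k)
    case 0
    then show ?thesis using m0[OF k] by (simp add: c_def)
  next
    case (Suc l)
    have "g (x (Suc l)) + g (x (Suc l)) \<le> g (x l) + g (x (Suc (Suc l)))"
      using x_in[of l] x_in[of "Suc (Suc l)"] w(1) k Suc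
      by (intro convex_on_exchange[OF conv]) (auto simp: x_Suc)
    then have "m l \<le> m (Suc l)" using w(1) by (simp add: m_def divide_simps)
    then show ?thesis by (simp add: c_def Suc)
  qed
  have a: "x k \<in> {0..<q}" if "k < n" for k
    using x_in[of k] x_in[of "Suc k"] that w(1) by (auto simp: x_Suc)
  have sum_c: "(\<Sum>k<n. c k) \<le> D"
    if D: "\<And>s t. 0 \<le> s \<Longrightarrow> s \<le> t \<Longrightarrow> t \<le> q \<Longrightarrow> g t - g s \<le> D * (t - s)" for D
  proof -
    have "(\<Sum>k<Suc j. c k) = m j" for j
      by (induction j) (auto simp: c_def)
    then have "(\<Sum>k<n. c k) = m n0" by (simp add: n_def)
    also have "\<dots> \<le> D"
      using D[of "x n0" "x (Suc n0)"] x_in[of n0] x_in[of "Suc n0"] w(1)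
      by (simp add: m_def n_def x_Suc divide_simps)
    finally show ?thesis .
  qed
  have approx: "\<bar>g t - g 0 - (\<Sum>k<n. c k * max 0 (t - x k))\<bar> \<le> \<epsilon>" if t: "t \<in> {0..q}" for t
  proof -
    obtain j where j: "j < n" "x j \<le> t" "t \<le> x (Suc j)"
    proof (cases "t = q")
      case True
      then show ?thesis using that[of n0] xn x_le[of n0 "Suc n0"] by (auto simp: n_def)
    next
      case False
      define j where "j = nat \<lfloor>t / w\<rfloor>"
      have "real j \<le> t / w" "t / w < real j + 1"
        using t w(1) by (auto simp: j_def)
      then have *: "x j \<le> t" "t < x (Suc j)" using w(1) by (simp_all add: x_def field_simps)
      have "j < n"
        using * x_le[of n j] xn t False by (meson atLeastAtMost_iff leI le_less_trans less_le order_trans)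
      then show ?thesis using that[of j] * by auto
    qed
    have "(\<Sum>k<n. c k * max 0 (t - x k)) = (\<Sum>k\<le>j. c k * (t - x k))"
    proof (rule sum.mono_neutral_cong_right)
      show "\<forall>i\<in>{..<n} - {..j}. c i * max 0 (t - x i) = 0"
      proof
        fix i assume "i \<in> {..<n} - {..j}"
        then show "c i * max 0 (t - x i) = 0" using x_le[of "Suc j" i] j by auto
      qed
      show "c i * max 0 (t - x i) = c i * (t - x i)" if "i \<in> {..j}" for i
        using x_le[of i j] j that by auto
    qed (use j in auto)
    also have "\<dots> = g (x j) - g (x 0) + m j * (t - x j)"
      unfolding c_def using w(1) by (intro sum_ramps_at) (simp add: m_def x_Suc)
    finally have eq: "(\<Sum>k<n. c k * max 0 (t - x k)) = g (x j) - g 0 + m j * (t - x j)"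
      by (simp add: x0)
    \<comment> \<open>By monotonicity \<open>g t\<close> and the interpolant both lie between
      \<open>g (x j)\<close> and \<open>g (x (Suc j))\<close>, which differ by less than
      \<open>\<epsilon>\<close>.\<close>
    have "m j * (t - x j) \<le> m j * w"
      using j m0[OF j(1)] by (intro mult_left_mono) (auto simp: x_Suc)
    then have "m j * (t - x j) \<le> g (x (Suc j)) - g (x j)" using w(1) by (simp add: m_def)
    moreover have "0 \<le> m j * (t - x j)" using j m0[OF j(1)] by simp
    moreover have "g (x j) \<le> g t" "g t \<le> g (x (Suc j))"
      using j t x_in[of j] x_in[of "Suc j"] by (auto intro!: mono_onD[OF mono])
    moreover have "\<bar>g (x (Suc j)) - g (x j)\<bar> < \<epsilon>"
      using \<delta>(2)[of "x j" "x (Suc j)"] x_in[of j] x_in[of "Suc j"] j w by (auto simp: dist_real_def x_Suc)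
    ultimately show ?thesis unfolding eq by linarith
  qed
  show thesis
    by (rule that[of n c x]) (use c0 a sum_c approx in auto)
qed

text \<open>Subtracting the line of slope \<open>d\<close> leaves an increasing convex function on
  \<open>[0, p]\<close>, approximated by ramps that are frozen at \<open>p\<close>. On
  \<open>[p, 1]\<close> the reflection \<open>- h (1 - t)\<close> is convex with slopes at most
  \<open>d\<close>, and its ramps become the functions \<open>min t (b k)\<close>. The term
  \<open>r * min t p\<close> carries what remains of the line.\<close>

lemma S_shaped_approx:
  assumes h: "S_shaped h p" and "0 < \<epsilon>"
    and slopes: "\<forall>s\<in>{p<..1}. \<forall>t\<in>{0<..p}. (h s - h p) / (s - p) \<le> (h t - h 0) / (t - 0)"
  obtains n m :: nat and a b c e :: "nat \<Rightarrow> real" and r :: real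
  where "\<And>k. k < n \<Longrightarrow> 0 \<le> c k \<and> a k \<in> {0..p}" "\<And>k. k < m \<Longrightarrow> 0 \<le> e k \<and> b k \<in> {p..1}" "0 \<le> r"
    "\<And>t. t \<in> {0..1} \<Longrightarrow> \<bar>h t - ((\<Sum>k<n. c k * (min t p - min t (a k))) +
       (\<Sum>k<m. e k * min t (b k)) + r * min t p)\<bar> \<le> \<epsilon>"
proof -
  have p: "0 < p" "p < 1" and cont: "continuous_on {0..1} h" and h01: "h 0 = 0" "h 1 = 1"
    and mono: "mono_on {0..1} h"
    and cc: "convex_on {0<..<p} h" "convex_on {p<..<1} (\<lambda>x. - h x)"
    using h by (auto simp: S_shaped_def distortion_function_def concave_on_def)
  have cont1: "continuous_on {0..p} h" and cont2: "continuous_on {p..1} (\<lambda>x. - h x)"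
    using p by (auto intro!: continuous_intros continuous_on_subset[OF cont])
  note conv = convex_on_Icc_if_convex_on_Ioo[OF cont1 cc(1)]
  note conc = convex_on_Icc_if_convex_on_Ioo[OF cont2 cc(2)]
  \<comment> \<open>A number separating the two families of chord slopes; the infimum is finite
    because every slope from \<open>p\<close> bounds the slopes from 0 from below.\<close>
  define d where "d = (INF t\<in>{0<..p}. (h t - h 0) / (t - 0))"
  have bdd: "bdd_below ((\<lambda>t. (h t - h 0) / (t - 0)) ` {0<..p})"
    using slopes p by (intro bdd_belowI2[of _ "(h 1 - h p) / (1 - p)"]) auto
  have d_le: "d \<le> h t / t" if "t \<in> {0<..p}" for t
    using cINF_lower[OF bdd that] h01 by (simp add: d_def)
  have le_d: "(h s - h p) / (s - p) \<le> d" if "s \<in> {p<..1}" for s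
    unfolding d_def using slopes p that by (intro cINF_greatest) auto
  have lower: "d * (t - s) \<le> h t - h s" if st: "0 \<le> s" "s \<le> t" "t \<le> p" for s t
  proof (cases "s = t")
    case False
    \<comment> \<open>As \<open>h 0 = 0\<close>, convexity makes \<open>h\<close> superadditive on
      \<open>[0, p]\<close>, so the bound on chords from 0 extends to all chords;
      \<open>upper\<close> moves chords to \<open>p\<close> in the same way.\<close>
    have "d * (t - s) \<le> h (t - s)" using d_le[of "t - s"] False st by (simp add: field_simps)
    also have "\<dots> \<le> h t - h s"
      using convex_on_exchange[OF conv, of 0 t s "t - s"] st h01 by simp
    finally show ?thesis .
  qed simp
  have upper: "h t - h s \<le> d * (t - s)" if st: "p \<le> s" "s \<le> t" "t \<le> 1" for s t
  proof (cases "s = t")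
    case False
    have "- h s + - h (p + (t - s)) \<le> - h p + - h t"
      using st by (intro convex_on_exchange[OF conc]) auto
    then have "h t - h s \<le> h (p + (t - s)) - h p" by simp
    also have "\<dots> \<le> d * (t - s)" using le_d[of "p + (t - s)"] False st by (simp add: field_simps)
    finally show ?thesis .
  qed simp

  define g1 where "g1 t = h t - d * t" for t
  define g2 where "g2 t = - h (1 - t)" for t
  have g1_conv: "convex_on {0..p} g1"
    unfolding g1_def by (intro convex_on_diff conv concave_on_linorderI) (auto simp: algebra_simps)
  have g1_cont: "continuous_on {0..p} g1" unfolding g1_def by (intro continuous_intros cont1)
  have g1_mono: "mono_on {0..p} g1"
    unfolding g1_def using lower by (intro mono_onI) (auto simp: algebra_simps)
  have \<epsilon>3: "0 < \<epsilon> / 3" using \<open>0 < \<epsilon>\<close> by simp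
  obtain n :: nat and c a :: "nat \<Rightarrow> real" where c: "\<And>k. k < n \<Longrightarrow> 0 \<le> c k" and a: "\<And>k. k < n \<Longrightarrow> a k \<in> {0..<p}"
    and g1: "\<And>t. t \<in> {0..p} \<Longrightarrow> \<bar>g1 t - g1 0 - (\<Sum>k<n. c k * max 0 (t - a k))\<bar> \<le> \<epsilon> / 3"
    by (rule convex_approx_ramps[OF g1_conv g1_cont g1_mono p(1) \<epsilon>3]) (blast intro: that)
  have g2_conv: "convex_on {0..1 - p} g2"
  proof (rule convex_onI)
    fix t x y :: real assume "0 < t" "t < 1" "x \<in> {0..1 - p}" "y \<in> {0..1 - p}"
    then show "g2 ((1 - t) *\<^sub>R x + t *\<^sub>R y) \<le> (1 - t) * g2 x + t * g2 y"
      using convex_onD[OF conc, of t "1 - x" "1 - y"] by (simp add: g2_def algebra_simps)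
  qed simp
  have g2_cont: "continuous_on {0..1 - p} g2"
    unfolding g2_def by (intro continuous_intros continuous_on_compose2[OF cont]) (use p in auto)
  have g2_mono: "mono_on {0..1 - p} g2"
    unfolding g2_def using p by (intro mono_onI) (auto intro!: mono_onD[OF mono])
  have "0 < 1 - p" using p by simp
  obtain m :: nat and e b' :: "nat \<Rightarrow> real" where e: "\<And>k. k < m \<Longrightarrow> 0 \<le> e k"
    and b': "\<And>k. k < m \<Longrightarrow> b' k \<in> {0..<1 - p}"
    and sum_e: "\<And>D. (\<And>s t. 0 \<le> s \<Longrightarrow> s \<le> t \<Longrightarrow> t \<le> 1 - p \<Longrightarrow> g2 t - g2 s \<le> D * (t - s))
        \<Longrightarrow> (\<Sum>k<m. e k) \<le> D"
    and g2: "\<And>t. t \<in> {0..1 - p} \<Longrightarrow> \<bar>g2 t - g2 0 - (\<Sum>k<m. e k * max 0 (t - b' k))\<bar> \<le> \<epsilon> / 3"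
    by (rule convex_approx_ramps[OF g2_conv g2_cont g2_mono \<open>0 < 1 - p\<close> \<epsilon>3]) (blast intro: that)
  define b where "b k = 1 - b' k" for k
  \<comment> \<open>On \<open>[0, p]\<close> every \<open>min t (b k)\<close> equals
    \<open>t\<close>, so these terms already contribute the slope \<open>\<Sum>k<m. e k\<close>;
    \<open>r\<close> is the part of \<open>d\<close> still missing.\<close>
  define r where "r = d - (\<Sum>k<m. e k)"
  have "(\<Sum>k<m. e k) \<le> d"
  proof (rule sum_e)
    fix s t assume "0 \<le> s" "s \<le> t" "t \<le> 1 - p"
    then show "g2 t - g2 s \<le> d * (t - s)" using upper[of "1 - t" "1 - s"] by (simp add: g2_def)
  qed
  then have r: "0 \<le> r" by (simp add: r_def)
  have b: "b k \<in> {p..1}" if "k < m" for k using b'[OF that] by (auto simp: b_def)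
  have head: "\<bar>h t - ((\<Sum>k<n. c k * max 0 (t - a k)) + d * t)\<bar> \<le> \<epsilon> / 3" if "t \<in> {0..p}" for t
    using g1[OF that] h01 by (simp add: g1_def algebra_simps)
  have tail: "\<bar>h t - (1 - (\<Sum>k<m. e k * max 0 (b k - t)))\<bar> \<le> \<epsilon> / 3" if "t \<in> {p..1}" for t
    using g2[of "1 - t"] that h01 by (simp add: g2_def b_def algebra_simps abs_minus_commute)
  have "\<bar>h t - ((\<Sum>k<n. c k * (min t p - min t (a k))) +
      (\<Sum>k<m. e k * min t (b k)) + r * min t p)\<bar> \<le> \<epsilon>" if t: "t \<in> {0..1}" for t
  proof (cases "t \<le> p")
    case True
    have "(\<Sum>k<n. c k * (min t p - min t (a k))) = (\<Sum>k<n. c k * max 0 (t - a k))"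
      using True by (intro sum.cong) (auto simp: min_def max_def)
    moreover have "(\<Sum>k<m. e k * min t (b k)) = (\<Sum>k<m. e k) * t"
      unfolding sum_distrib_right using True b by (intro sum.cong) (force simp: min_def)+
    ultimately show ?thesis
      using head[of t] t True \<open>0 < \<epsilon>\<close> by (simp add: r_def algebra_simps)
  next
    case False
    have "(\<Sum>k<n. c k * (min t p - min t (a k))) = (\<Sum>k<n. c k * max 0 (p - a k))"
      using False a by (intro sum.cong) (force simp: min_def max_def)+
    moreover have "(\<Sum>k<m. e k * min t (b k))
        = (\<Sum>k<m. e k * p) + (\<Sum>k<m. e k * max 0 (b k - p)) - (\<Sum>k<m. e k * max 0 (b k - t))"
      unfolding sum.distrib[symmetric] sum_subtractf[symmetric]
    proof (rule sum.cong)
      fix k assume "k \<in> {..<m}"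
      then have "p \<le> b k" using b by auto
      then have eq: "min t (b k) = p + max 0 (b k - p) - max 0 (b k - t)" by (auto simp: min_def max_def)
      show "e k * min t (b k) = e k * p + e k * max 0 (b k - p) - e k * max 0 (b k - t)"
        unfolding eq by (simp only: distrib_left right_diff_distrib)
    qed simp
    moreover have "(\<Sum>k<m. e k * p) = d * p - r * p"
      by (simp add: r_def left_diff_distrib flip: sum_distrib_right)
    moreover have "min t p = p" using False by simp
    moreover have "p \<in> {0..p}" "p \<in> {p..1}" "t \<in> {p..1}" using p t False by auto
    \<comment> \<open>Beyond \<open>p\<close> the approximant is the head at \<open>p\<close> plus
      the difference of the tail between \<open>t\<close> and \<open>p\<close>; hence three errors
      of \<open>\<epsilon> / 3\<close>.\<close>
    note approx3 = head[OF this(1)] tail[OF this(2)] tail[OF this(3)]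
    ultimately show ?thesis using approx3 by (simp only: abs_le_iff) linarith
  qed
  then show thesis using that[of n c a m e b r] c a b e r by (auto simp: less_imp_le)
qed

section \<open>Necessity\<close>

text \<open>In a proper split of \<open>A\<close> one part has at most half the probability of
  \<open>A\<close>; repeated halving goes below any \<open>e\<close>.\<close>

lemma (in prob_space) atomless_small_subset:
  assumes "atomless M" and A: "A \<in> events" "0 < prob A" and "0 < e"
  obtains B where "B \<in> events" "B \<subseteq> A" "0 < prob B" "prob B < e"
proof -
  have halve: "\<exists>B\<in>events. B \<subseteq> A \<and> 0 < prob B \<and> prob B \<le> prob A / 2"
    if A: "A \<in> events" "0 < prob A" for A
  proof -
    obtain B where B: "B \<in> events" "B \<subseteq> A" "0 < prob B" "prob B < prob A"
      using \<open>atomless M\<close>[unfolded atomless_def, rule_format, of A] A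
      by (auto simp: emeasure_eq_measure ennreal_less_iff)
    have "prob (A - B) = prob A - prob B"
      using B A by (intro finite_measure_Diff) auto
    then show ?thesis
      using B A by (cases "prob B \<le> prob A / 2") (auto intro: bexI[of _ B] bexI[of _ "A - B"])
  qed
  have "\<exists>B\<in>events. B \<subseteq> A \<and> 0 < prob B \<and> prob B \<le> prob A / 2 ^ n" for n :: nat
  proof (induction n)
    case (Suc n)
    then obtain B where B: "B \<in> events" "B \<subseteq> A" "0 < prob B" "prob B \<le> prob A / 2 ^ n" by auto
    from halve[OF B(1,3)] obtain B' where "B' \<in> events" "B' \<subseteq> B" "0 < prob B'" "prob B' \<le> prob B / 2"
      by auto
    then show ?case using B by (intro bexI[of _ B']) auto
  qed (use A in auto)
  moreover obtain n :: nat where "prob A / e < 2 ^ n" using real_arch_pow[of 2] by auto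
  then have "prob A / 2 ^ n < e" using \<open>0 < e\<close> by (simp add: field_simps)
  ultimately show thesis by (meson that le_less_trans)
qed

text \<open>Sierpinski's theorem: exhaust \<open>D\<close> greedily, each step taking at least half of what is
  still admissible, so that the steps cannot stop short of the measure \<open>t\<close>.\<close>

lemma (in prob_space) atomless_subset_prob:
  assumes "atomless M" and D: "D \<in> events" and t: "0 \<le> t" "t \<le> prob D"
  obtains B where "B \<in> events" "B \<subseteq> D" "prob B = t"
proof -
  define F where "F B = {E \<in> events. E \<subseteq> D - B \<and> prob B + prob E \<le> t}" for B
  have "\<exists>B. \<forall>n. (B n \<in> events \<and> B n \<subseteq> D \<and> prob (B n) \<le> t) \<and>
          (B n \<subseteq> B (Suc n) \<and> (\<forall>E\<in>F (B n). prob E \<le> 2 * (prob (B (Suc n)) - prob (B n))))"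
  proof (rule dependent_nat_choice)
    show "\<exists>B. B \<in> events \<and> B \<subseteq> D \<and> prob B \<le> t" using t by (intro exI[of _ "{}"]) auto
  next
    fix B and n :: nat assume B: "B \<in> events \<and> B \<subseteq> D \<and> prob B \<le> t"
    define s where "s = (SUP E\<in>F B. prob E)"
    have ne: "{} \<in> F B" using B by (auto simp: F_def)
    have bdd: "bdd_above (prob ` F B)" by (auto intro: bdd_aboveI[of _ 1])
    have le_s: "prob E \<le> s" if "E \<in> F B" for E
      unfolding s_def by (rule cSUP_upper[OF that bdd])
    obtain E where E: "E \<in> F B" "s \<le> 2 * prob E"
    proof (cases "s \<le> 0")
      case True
      then show ?thesis using that[OF ne] by simp
    next
      case False
      then have "s / 2 < s" by simp
      then obtain E where "E \<in> F B" "s / 2 < prob E"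
        unfolding s_def using ne bdd by (subst (asm) less_cSUP_iff) auto
      then show ?thesis using that[of E] by simp
    qed
    have "prob (B \<union> E) = prob B + prob E"
      using B E by (intro finite_measure_Union) (auto simp: F_def)
    moreover have "prob E' \<le> 2 * prob E" if "E' \<in> F B" for E'
      using le_s[OF that] E(2) by simp
    ultimately show "\<exists>B'. (B' \<in> events \<and> B' \<subseteq> D \<and> prob B' \<le> t) \<and>
        (B \<subseteq> B' \<and> (\<forall>E\<in>F B. prob E \<le> 2 * (prob B' - prob B)))"
      using B E by (intro exI[of _ "B \<union> E"]) (auto simp: F_def)
  qed
  then obtain B where "\<forall>n. (B n \<in> events \<and> B n \<subseteq> D \<and> prob (B n) \<le> t) \<and>
      (B n \<subseteq> B (Suc n) \<and> (\<forall>E\<in>F (B n). prob E \<le> 2 * (prob (B (Suc n)) - prob (B n))))" ..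
  then have B: "B n \<in> events" "B n \<subseteq> D" "prob (B n) \<le> t" "B n \<subseteq> B (Suc n)"
    "E \<in> F (B n) \<Longrightarrow> prob E \<le> 2 * (prob (B (Suc n)) - prob (B n))" for n E
    by simp_all
  define U where "U = (\<Union>n. B n)"
  have U: "U \<in> events" "U \<subseteq> D" "B n \<subseteq> U" for n using B by (auto simp: U_def)
  have lim: "(\<lambda>n. prob (B n)) \<longlonglongrightarrow> prob U"
    unfolding U_def using B by (intro finite_Lim_measure_incseq incseq_SucI) auto
  have Ut: "prob U \<le> t" using B(3) by (intro LIMSEQ_le_const2[OF lim]) auto
  have "prob U = t"
  proof (rule ccontr)
    assume "prob U \<noteq> t"
    with Ut have less: "prob U < t" by simp
    have "prob (D - U) = prob D - prob U" using D U by (intro finite_measure_Diff) auto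
    then obtain E where E: "E \<in> events" "E \<subseteq> D - U" "0 < prob E" "prob E < t - prob U"
      using atomless_small_subset[OF \<open>atomless M\<close>, of "D - U" "t - prob U"] less t D U by auto
    \<comment> \<open>A small event outside \<open>U\<close> would have stayed admissible at every
      step, so twice each increment would dominate its probability, although the increments tend to
      0.\<close>
    have "E \<in> F (B n)" for n
      using E U(3)[of n] finite_measure_mono[OF U(3)[of n] U(1)] by (auto simp: F_def)
    then have "prob E \<le> 2 * (prob (B (Suc n)) - prob (B n))" for n by (rule B(5))
    moreover have "(\<lambda>n. 2 * (prob (B (Suc n)) - prob (B n))) \<longlonglongrightarrow> 2 * (prob U - prob U)"
      by (intro tendsto_intros lim LIMSEQ_Suc)
    ultimately have "prob E \<le> 2 * (prob U - prob U)" by (intro LIMSEQ_le_const) auto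
    with E(3) show False by simp
  qed
  with U that show thesis by blast
qed

text \<open>The bounds on \<open>\<gamma>\<close> are the Frechet bounds for an intersection.
  \<open>B\<close> takes mass \<open>\<gamma>\<close> inside \<open>A\<close> and
  \<open>\<beta> - \<gamma>\<close> outside, where
  \<open>\<alpha> + \<beta> - 1 \<le> \<gamma>\<close> leaves enough room.\<close>

lemma (in prob_space) atomless_two_events:
  assumes "atomless M" and "\<alpha> \<in> {0..1}" "\<beta> \<in> {0..1}"
    and "0 \<le> \<gamma>" "\<alpha> + \<beta> - 1 \<le> \<gamma>" "\<gamma> \<le> \<alpha>" "\<gamma> \<le> \<beta>"
  obtains A B where "A \<in> events" "B \<in> events" "prob A = \<alpha>" "prob B = \<beta>" "prob (A \<inter> B) = \<gamma>"
proof -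
  note sub = atomless_subset_prob[OF \<open>atomless M\<close>]
  obtain A where A: "A \<in> events" "prob A = \<alpha>"
    using sub[of "space M" \<alpha>] assms prob_space by auto
  obtain A1 where A1: "A1 \<in> events" "A1 \<subseteq> A" "prob A1 = \<gamma>"
    using sub[of A \<gamma>] A assms by auto
  obtain B1 where B1: "B1 \<in> events" "B1 \<subseteq> space M - A" "prob B1 = \<beta> - \<gamma>"
    using sub[of "space M - A" "\<beta> - \<gamma>"] A assms prob_compl[of A] by auto
  have "prob (A1 \<union> B1) = \<beta>"
    using A1 B1 by (subst finite_measure_Union) auto
  moreover have "A \<inter> (A1 \<union> B1) = A1" using A1 B1 by auto
  ultimately show thesis using that[of A "A1 \<union> B1"] A A1 B1 by auto
qed

section \<open>Distorted expectations of sums of indicators\<close>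

lemma (in prob_space) eq_in_law_indicator:
  assumes "A \<in> events" "B \<in> events" "prob A = prob B"
  shows "eq_in_law M (indicator A) (indicator B :: 'a \<Rightarrow> real)"
  unfolding eq_in_law_def
proof (rule measure_eqI)
  fix T assume "T \<in> sets (distr M borel (indicator A :: 'a \<Rightarrow> real))"
  then have T: "T \<in> sets borel" by simp
  have *: "prob ((indicator A :: 'a \<Rightarrow> real) -` T \<inter> space M) =
     (if 1 \<in> T then prob A else 0) + (if 0 \<in> T then 1 - prob A else 0)"
    if A: "A \<in> events" for A
  proof -
    have "(indicator A :: 'a \<Rightarrow> real) -` T \<inter> space M =
        (if 1 \<in> T then A else {}) \<union> (if 0 \<in> T then space M - A else {})"
      using sets.sets_into_space[OF A] by (auto simp: indicator_def of_bool_def split: if_splits)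
    then show ?thesis using A
      by (simp add: finite_measure_Union prob_compl del: Un_Diff_cancel)
  qed
  show "emeasure (distr M borel (indicator A)) T = emeasure (distr M borel (indicator B)) T"
    using T assms by (simp add: emeasure_distr emeasure_eq_measure *)
qed simp

text \<open>The survival function of the sum is a step function, given by the union on
  \<open>[0, 1)\<close> and by the intersection on \<open>[1, 2)\<close>. For given probabilities of
  \<open>A\<close> and \<open>B\<close> the overlap is thus the only parameter.\<close>

lemma (in prob_space) distorted_expectation_indicator_add:
  assumes [measurable]: "A \<in> events" "B \<in> events" and "h 0 = 0" "h 1 = 1"
  shows "distorted_expectation M h (\<lambda>\<omega>. indicator A \<omega> + indicator B \<omega>)
    = h (prob (A \<inter> B)) + h (prob A + prob B - prob (A \<inter> B))"
proof -
  let ?Z = "\<lambda>\<omega>. indicator A \<omega> + indicator B \<omega> :: real"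
  let ?S = "\<lambda>x. prob {\<omega> \<in> space M. ?Z \<omega> > x}"
  have AB: "A \<subseteq> space M" "B \<subseteq> space M" by (auto intro: sets.sets_into_space[THEN subsetD, OF assms(1)] sets.sets_into_space[THEN subsetD, OF assms(2)])
  have s0: "?S x = 1" if "x < 0" for x
  proof -
    have "{\<omega> \<in> space M. ?Z \<omega> > x} = space M" using that by (auto simp: indicator_def)
    then show ?thesis using prob_space by simp
  qed
  have s1: "?S x = prob (A \<union> B)" if "0 \<le> x" "x < 1" for x
    using that AB by (intro arg_cong[where f = prob]) (auto simp: indicator_def split: if_splits)
  have s2: "?S x = prob (A \<inter> B)" if "1 \<le> x" "x < 2" for x
    using that AB by (intro arg_cong[where f = prob]) (auto simp: indicator_def split: if_splits)
  have s3: "?S x = 0" if "2 \<le> x" for x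
  proof -
    have "{\<omega> \<in> space M. ?Z \<omega> > x} = {}" using that by (auto simp: indicator_def)
    then show ?thesis by (simp only: measure_empty)
  qed
  have pos: "indicator {0..} x * h (?S x) =
      indicator {0..<1} x * h (prob (A \<union> B)) + indicator {1..<2} x * h (prob (A \<inter> B))" for x :: real
  proof -
    consider "x < 0" | "0 \<le> x" "x < 1" | "1 \<le> x" "x < 2" | "2 \<le> x" by linarith
    then show ?thesis by cases (simp_all add: s1 s2 s3 \<open>h 0 = 0\<close>)
  qed
  have neg: "AE x in lborel. indicator {..0} x * (h (?S x) - 1) = 0"
    using AE_lborel_singleton[of "0::real"] by eventually_elim (auto simp: indicator_def s0 prob_space \<open>h 1 = 1\<close>)
  have "(LBINT x:{0..}. h (?S x)) = h (prob (A \<union> B)) + h (prob (A \<inter> B))"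
    unfolding set_lebesgue_integral_def real_scaleR_def pos
    by (subst Bochner_Integration.integral_add) auto
  moreover have "(LBINT x:{..0}. h (?S x) - 1) = 0"
    unfolding set_lebesgue_integral_def real_scaleR_def by (rule integral_eq_zero_AE[OF neg])
  moreover have "prob (A \<union> B) = prob A + prob B - prob (A \<inter> B)"
    by (rule measure_Un3) (auto simp: fmeasurable_eq_sets)
  ultimately show ?thesis by (simp add: distorted_expectation_def)
qed

section \<open>Elementary properties of copulas\<close>

lemma measure_uniform_01_atMost:
  "u \<in> {0..1} \<Longrightarrow> measure (uniform_measure lborel {0..1::real}) {..u} = u"
proof -
  assume u: "u \<in> {0..1}"
  then have "{0..1} \<inter> {..u} = {0..u}" by auto
  then show ?thesis using u by (simp add: measure_uniform_measure)
qed

lemma is_copulaE: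
  assumes "is_copula C"
  obtains \<mu> :: "(real \<times> real) measure" where "prob_space \<mu>" "sets \<mu> = sets borel"
    "\<And>x. x \<in> {0..1} \<Longrightarrow> measure \<mu> (fst -` {..x}) = x"
    "\<And>x. x \<in> {0..1} \<Longrightarrow> measure \<mu> (snd -` {..x}) = x"
    "\<And>u v. u \<in> {0..1} \<Longrightarrow> v \<in> {0..1} \<Longrightarrow> C u v = measure \<mu> ({..u} \<times> {..v})"
    "\<And>x y :: real. {..x} \<times> {..y} \<in> sets \<mu>"
    "\<And>x :: real. fst -` {..x} \<in> sets \<mu>" "\<And>x :: real. snd -` {..x} \<in> sets \<mu>"
proof -
  obtain \<mu> :: "(real \<times> real) measure" where \<mu>: "prob_space \<mu>" "sets \<mu> = sets borel"
    "distr \<mu> borel fst = uniform_measure lborel {0..1}"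
    "distr \<mu> borel snd = uniform_measure lborel {0..1}"
    and C: "\<And>u v. u \<in> {0..1} \<Longrightarrow> v \<in> {0..1} \<Longrightarrow> C u v = measure \<mu> ({..u} \<times> {..v})"
    using assms unfolding is_copula_def by blast
  have sp: "space \<mu> = UNIV" using sets_eq_imp_space_eq[OF \<mu>(2)] by simp
  have meas: "fst \<in> measurable \<mu> borel" "snd \<in> measurable \<mu> borel"
    by (subst measurable_cong_sets[OF \<mu>(2) refl], intro borel_measurable_continuous_onI continuous_intros)+
  have "measure \<mu> (fst -` {..x}) = x" if "x \<in> {0..1}" for x
    using measure_uniform_01_atMost[OF that] meas(1) unfolding \<mu>(3)[symmetric]
    by (subst (asm) measure_distr) (auto simp: sp)
  moreover have "measure \<mu> (snd -` {..x}) = x" if "x \<in> {0..1}" for x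
    using measure_uniform_01_atMost[OF that] meas(2) unfolding \<mu>(4)[symmetric]
    by (subst (asm) measure_distr) (auto simp: sp)
  moreover have "{..x} \<times> {..y} \<in> sets \<mu>" "fst -` {..x} \<in> sets \<mu>" "snd -` {..x} \<in> sets \<mu>" for x y :: real
    by (auto simp: \<mu>(2) intro!: borel_closed closed_Times closed_vimage continuous_intros)
  ultimately show thesis using that \<mu>(1,2) C by blast
qed

text \<open>The larger rectangle is covered by the smaller one and two strips, whose masses
  \<open>u' - u\<close> and \<open>v' - v\<close> come from the uniform marginals.\<close>

lemma copula_mono_Lipschitz:
  assumes "is_copula C" and "0 \<le> u" "u \<le> u'" "u' \<le> 1" "0 \<le> v" "v \<le> v'" "v' \<le> 1"
  shows "C u v \<le> C u' v'" "C u' v' \<le> C u v + (u' - u) + (v' - v)"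
proof -
  obtain \<mu> :: "(real \<times> real) measure" where "prob_space \<mu>" "sets \<mu> = sets borel"
    and \<mu>: "\<And>x. x \<in> {0..1} \<Longrightarrow> measure \<mu> (fst -` {..x}) = x"
      "\<And>x. x \<in> {0..1} \<Longrightarrow> measure \<mu> (snd -` {..x}) = x"
      "\<And>u v. u \<in> {0..1} \<Longrightarrow> v \<in> {0..1} \<Longrightarrow> C u v = measure \<mu> ({..u} \<times> {..v})"
    and [simp]: "\<And>x y :: real. {..x} \<times> {..y} \<in> sets \<mu>"
      "\<And>x :: real. fst -` {..x} \<in> sets \<mu>" "\<And>x :: real. snd -` {..x} \<in> sets \<mu>"
    by (rule is_copulaE[OF assms(1)], rule that)
  interpret prob_space \<mu> by fact
  show "C u v \<le> C u' v'"
    using assms by (simp add: \<mu>) (intro finite_measure_mono; auto)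
  have "C u' v' \<le> prob (({..u} \<times> {..v}) \<union> ((fst -` {..u'} - fst -` {..u}) \<union> (snd -` {..v'} - snd -` {..v})))"
    using assms by (simp add: \<mu>) (intro finite_measure_mono sets.Un sets.Diff; auto)
  also have "\<dots> \<le> C u v + (prob (fst -` {..u'} - fst -` {..u}) + prob (snd -` {..v'} - snd -` {..v}))"
    using assms by (intro order_trans[OF measure_Un_le] add_mono sets.Un sets.Diff)
      (auto simp: \<mu> intro!: measure_Un_le)
  also have "prob (fst -` {..u'} - fst -` {..u}) = u' - u"
    using assms by (subst finite_measure_Diff) (auto simp: \<mu>)
  also have "prob (snd -` {..v'} - snd -` {..v}) = v' - v"
    using assms by (subst finite_measure_Diff) (auto simp: \<mu>)
  finally show "C u' v' \<le> C u v + (u' - u) + (v' - v)" by simp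
qed

lemma copula_boundary:
  assumes "is_copula C" "u \<in> {0..1}"
  shows "C 0 u = 0" "C u 0 = 0" "C 1 u = u" "C u 1 = u"
proof -
  obtain \<mu> :: "(real \<times> real) measure" where "prob_space \<mu>" "sets \<mu> = sets borel"
    and \<mu>: "\<And>x. x \<in> {0..1} \<Longrightarrow> measure \<mu> (fst -` {..x}) = x"
      "\<And>x. x \<in> {0..1} \<Longrightarrow> measure \<mu> (snd -` {..x}) = x"
      "\<And>u v. u \<in> {0..1} \<Longrightarrow> v \<in> {0..1} \<Longrightarrow> C u v = measure \<mu> ({..u} \<times> {..v})"
    and [simp]: "\<And>x y :: real. {..x} \<times> {..y} \<in> sets \<mu>"
      "\<And>x :: real. fst -` {..x} \<in> sets \<mu>" "\<And>x :: real. snd -` {..x} \<in> sets \<mu>"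
    by (rule is_copulaE[OF assms(1)], rule that)
  interpret prob_space \<mu> by fact
  have rect: "fst -` {..x} \<inter> snd -` {..y} = {..x} \<times> {..y}" for x y :: real by auto
  have "C 0 u \<le> prob (fst -` {..0})" "C u 0 \<le> prob (snd -` {..0})"
    using assms by (simp_all add: \<mu>(3)) (intro finite_measure_mono; auto)+
  moreover have "0 \<le> C 0 u" "0 \<le> C u 0" using assms by (simp_all add: \<mu>(3))
  ultimately show "C 0 u = 0" "C u 0 = 0" by (simp_all add: \<mu>(1,2))
  have "prob (fst -` {..1} \<inter> snd -` {..u}) = prob (snd -` {..u})"
    using AE_prob_1[of "fst -` {..1}"] by (intro finite_measure_eq_AE) (auto simp: \<mu>(1) elim: eventually_mono)
  then show "C 1 u = u" using assms by (simp add: \<mu> rect)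
  have "prob (snd -` {..1} \<inter> fst -` {..u}) = prob (fst -` {..u})"
    using AE_prob_1[of "snd -` {..1}"] by (intro finite_measure_eq_AE) (auto simp: \<mu>(2) elim: eventually_mono)
  then show "C u 1 = u" using assms by (simp add: \<mu> rect Int_commute)
qed

text \<open>With overlap \<open>\<gamma>0\<close> the complements of \<open>A\<close> and
  \<open>B\<close> meet with probability \<open>C (1 - \<alpha>) (1 - \<beta>)\<close>. Distribution
  functions of indicators take only the values 0, 1 and one more, so this value and the boundary
  values make \<open>C\<close> a copula of the two indicators; \<open>\<gamma>\<close> is the
  overlap of a competing pair with the same laws.\<close>

lemma (in prob_space) maximal_overlap:
  assumes "atomless M" and C: "is_copula C" and max: "universally_maximal M h C"
    and h: "h 0 = 0" "h 1 = 1" and \<alpha>: "\<alpha> \<in> {0..1}" and \<beta>: "\<beta> \<in> {0..1}"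
    and \<gamma>: "0 \<le> \<gamma>" "\<alpha> + \<beta> - 1 \<le> \<gamma>" "\<gamma> \<le> \<alpha>" "\<gamma> \<le> \<beta>"
    and \<gamma>0: "\<gamma>0 = \<alpha> + \<beta> - 1 + C (1 - \<alpha>) (1 - \<beta>)"
  shows "h \<gamma> + h (\<alpha> + \<beta> - \<gamma>) \<le> h \<gamma>0 + h (\<alpha> + \<beta> - \<gamma>0)"
proof -
  have "0 \<le> \<gamma>0" "\<alpha> + \<beta> - 1 \<le> \<gamma>0" "\<gamma>0 \<le> \<alpha>" "\<gamma>0 \<le> \<beta>"
    unfolding \<gamma>0
    using \<alpha> \<beta> copula_mono_Lipschitz[OF C, of 0 "1 - \<alpha>" "1 - \<beta>" "1 - \<beta>"]
      copula_mono_Lipschitz[OF C, of "1 - \<alpha>" 1 "1 - \<beta>" "1 - \<beta>"]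
      copula_mono_Lipschitz[OF C, of "1 - \<alpha>" "1 - \<alpha>" "1 - \<beta>" 1]
      copula_boundary[OF C, of "1 - \<alpha>"] copula_boundary[OF C, of "1 - \<beta>"]
    by auto
  from atomless_two_events[OF \<open>atomless M\<close> \<alpha> \<beta> this]
  obtain A B where A: "A \<in> events" "prob A = \<alpha>" and B: "B \<in> events" "prob B = \<beta>"
    and AB: "prob (A \<inter> B) = \<gamma>0"
    by blast
  obtain A' B' where A': "A' \<in> events" "prob A' = \<alpha>" and B': "B' \<in> events" "prob B' = \<beta>"
    and AB': "prob (A' \<inter> B') = \<gamma>"
    using atomless_two_events[OF \<open>atomless M\<close> \<alpha> \<beta> \<gamma>] by blast
  have rv: "(indicator D :: 'a \<Rightarrow> real) \<in> bounded_rvs M" if "D \<in> events" for D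
    using that by (auto simp: bounded_rvs_def bounded_iff indicator_def intro!: exI[of _ 1])
  have le: "{\<omega> \<in> space M. (indicator D \<omega> :: real) \<le> x} =
      (if x < 0 then {} else if x < 1 then space M - D else space M)" if "D \<in> events" for D x
    using sets.sets_into_space[OF that] by (auto simp: indicator_def split: if_splits)
  have "copula_of M C (indicator A) (indicator B)"
    unfolding copula_of_def
  proof (intro allI)
    fix x y :: real
    have *: "{\<omega> \<in> space M. indicator A \<omega> \<le> x \<and> indicator B \<omega> \<le> y} =
       {\<omega> \<in> space M. indicator A \<omega> \<le> x} \<inter> {\<omega> \<in> space M. indicator B \<omega> \<le> y}" by auto
    have "(space M - A) \<inter> (space M - B) = space M - (A \<union> B)" by auto
    moreover have "prob (A \<union> B) = \<alpha> + \<beta> - \<gamma>0"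
      using A B AB by (subst measure_Un3) (auto simp: fmeasurable_eq_sets)
    ultimately have C_eq: "prob ((space M - A) \<inter> (space M - B)) = C (1 - \<alpha>) (1 - \<beta>)"
      using A B by (simp add: prob_compl \<gamma>0)
    have bd: "C 0 t = 0" "C t 0 = 0" "C 1 t = t" "C t 1 = t" if "t \<in> {0, 1, 1 - \<alpha>, 1 - \<beta>}" for t
      using that \<alpha> \<beta> copula_boundary[OF C, of t] by auto
    have cA: "prob (space M - A) = 1 - \<alpha>" and cB: "prob (space M - B) = 1 - \<beta>"
      using A B by (simp_all add: prob_compl)
    have i: "space M \<inter> (space M - B) = space M - B" "(space M - A) \<inter> space M = space M - A" by auto
    consider "x < 0" | "0 \<le> x" "x < 1" | "1 \<le> x" by linarith
    then show "prob {\<omega> \<in> space M. indicator A \<omega> \<le> x \<and> indicator B \<omega> \<le> y} =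
       C (prob {\<omega> \<in> space M. indicator A \<omega> \<le> x}) (prob {\<omega> \<in> space M. indicator B \<omega> \<le> y})"
      unfolding * le[OF A(1)] le[OF B(1)]
      by cases (simp_all only: not_less if_True if_False Int_empty_left Int_empty_right Int_absorb
        i measure_empty prob_space C_eq cA cB bd insertI1 insertI2 split: if_split, auto simp: bd)
  qed
  then have "distorted_expectation M h (\<lambda>\<omega>. indicator A' \<omega> + indicator B' \<omega>)
      \<le> distorted_expectation M h (\<lambda>\<omega>. indicator A \<omega> + indicator B \<omega>)"
    using A A' B B'
    by (intro max[unfolded universally_maximal_def, rule_format] rv eq_in_law_indicator) auto
  then show ?thesis
    using A A' B B' AB AB' by (simp add: distorted_expectation_indicator_add h)
qed

text \<open>Testing \<open>C\<close> on pairs of indicators of events with probabilities \<open>\<alpha>\<close> and \<open>\<beta>\<close> gives the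
  hypothesis \<open>max\<close>; the number \<open>\<alpha> + \<beta> - 1 + C (1 - \<alpha>) (1 - \<beta>)\<close> is the probability of the
  intersection.\<close>

lemma strictly_S_shaped_overlap_imp_C_pm:
  assumes h: "strictly_S_shaped h p" and C: "is_copula C"
    and max: "\<And>\<alpha> \<beta> \<gamma>. \<alpha> \<in> {0..1} \<Longrightarrow> \<beta> \<in> {0..1} \<Longrightarrow> 0 \<le> \<gamma> \<Longrightarrow> \<alpha> + \<beta> - 1 \<le> \<gamma> \<Longrightarrow> \<gamma> \<le> \<alpha> \<Longrightarrow> \<gamma> \<le> \<beta> \<Longrightarrow>
      h \<gamma> + h (\<alpha> + \<beta> - \<gamma>) \<le> h (\<alpha> + \<beta> - 1 + C (1 - \<alpha>) (1 - \<beta>)) + h (1 - C (1 - \<alpha>) (1 - \<beta>))"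
  shows "\<forall>u\<in>{0..1}. \<forall>v\<in>{0..1}. C u v = C_pm p u v"
    and "\<forall>s\<in>{p<..1}. \<forall>t\<in>{0<..p}. (h s - h p) / (s - p) \<le> (h t - h 0) / (t - 0)"
proof -
  have p: "0 < p" "p < 1" and cont: "continuous_on {0..1} h" and h01: "h 0 = 0" "h 1 = 1"
    and sconv: "strictly_convex_on {0<..<p} h" and sconc: "strictly_convex_on {p<..<1} (\<lambda>x. - h x)"
    using h by (auto simp: strictly_S_shaped_def S_shaped_def distortion_function_def strictly_concave_on_def)
  have cont1: "continuous_on {0..p} h" and cont2: "continuous_on {p..1} (\<lambda>x. - h x)"
    using p by (auto intro!: continuous_intros continuous_on_subset[OF cont])
  note ex1 = strictly_convex_on_exchange[OF cont1 sconv]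
  note ex2 = strictly_convex_on_exchange[OF cont2 sconc]
  have conv: "convex_on {0..p} h"
    using convex_on_Icc_if_convex_on_Ioo[OF cont1 strictly_convex_on_imp_convex_on[OF sconv]] .
  have conc: "convex_on {p..1} (\<lambda>x. - h x)"
    using convex_on_Icc_if_convex_on_Ioo[OF cont2 strictly_convex_on_imp_convex_on[OF sconc]] .
  have bounds: "0 \<le> C u v" "u + v - 1 \<le> C u v" "C u v \<le> u" "C u v \<le> v"
    if "u \<in> {0..1}" "v \<in> {0..1}" for u v
    using that copula_mono_Lipschitz[OF C, of 0 u v v]
      copula_mono_Lipschitz[OF C, of u 1 v v] copula_mono_Lipschitz[OF C, of u u v 1]
      copula_boundary[OF C, of u] copula_boundary[OF C, of v] by auto

  \<comment> \<open>\<open>d \<alpha>\<close> is the overlap that \<open>C\<close> gives to two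
    events of probability \<open>\<alpha>\<close>. The aim is \<open>d \<alpha> = \<alpha>\<close>
    on \<open>[p, 1]\<close>, that is \<open>C w w = w\<close> for
    \<open>w \<le> 1 - p\<close>.\<close>
  define d where "d \<alpha> = 2 * \<alpha> - 1 + C (1 - \<alpha>) (1 - \<alpha>)" for \<alpha>
  have d_le: "d \<alpha> \<le> \<alpha>" if "\<alpha> \<in> {0..1}" for \<alpha>
    using bounds(3)[of "1 - \<alpha>" "1 - \<alpha>"] that by (auto simp: d_def)
  have d_eq: "d \<alpha> = \<alpha>" if \<alpha>: "\<alpha> \<in> {p..1}" "p < d \<alpha>" for \<alpha>
  proof (rule ccontr)
    assume "d \<alpha> \<noteq> \<alpha>"
    then have less: "d \<alpha> < \<alpha>" using d_le[of \<alpha>] \<alpha> p by auto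
    have "2 * \<alpha> - d \<alpha> \<le> 1" using bounds(1)[of "1 - \<alpha>" "1 - \<alpha>"] \<alpha> p by (auto simp: d_def)
    \<comment> \<open>Overlap and union both have probability in \<open>[p, 1]\<close>, where strict
      concavity makes complete overlap strictly better.\<close>
    then have "- h \<alpha> + - h \<alpha> < - h (d \<alpha>) + - h (2 * \<alpha> - d \<alpha>)"
      using less \<alpha> by (intro ex2) auto
    moreover have "h \<alpha> + h (\<alpha> + \<alpha> - \<alpha>) \<le> h (d \<alpha>) + h (2 * \<alpha> - d \<alpha>)"
      using max[of \<alpha> \<alpha> \<alpha>] \<alpha> p by (auto simp: d_def)
    ultimately show False by simp
  qed
  have "continuous_on {0..1} d"
    unfolding d_def
  proof (rule continuous_on_add[OF _ continuous_onI])
    fix x e :: real assume e: "0 < e" "x \<in> {0..1}"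
    have L: "\<bar>C (1 - y) (1 - y) - C (1 - x) (1 - x)\<bar> \<le> 2 * \<bar>x - y\<bar>" if "y \<in> {0..1}" for y
      using copula_mono_Lipschitz[OF C, of "1 - y" "1 - x" "1 - y" "1 - x"]
        copula_mono_Lipschitz[OF C, of "1 - x" "1 - y" "1 - x" "1 - y"] that e
      by (cases "x \<le> y") (auto simp: abs_if)
    have "dist (C (1 - y) (1 - y)) (C (1 - x) (1 - x)) \<le> e"
      if "y \<in> {0..1}" "dist y x < e / 2" for y
      using L[OF that(1)] that(2) by (simp add: dist_real_def abs_minus_commute)
    then show "\<exists>\<delta>>0. \<forall>y\<in>{0..1}. dist y x < \<delta> \<longrightarrow> dist (C (1 - y) (1 - y)) (C (1 - x) (1 - x)) \<le> e"
      using e by (intro exI[of _ "e / 2"]) auto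
  qed (intro continuous_intros)
  then have d_cont: "continuous_on {a..1} d" if "a \<in> {0..1}" for a
    using that by (auto elim: continuous_on_subset)
  have d1: "d 1 = 1" using copula_boundary[OF C, of 0] by (simp add: d_def)
  \<comment> \<open>The intermediate value theorem gives \<open>x \<ge> \<alpha>\<close> with
    \<open>d x = y\<close>, and \<open>d_eq\<close> turns this into \<open>x = y\<close> because
    \<open>y > p\<close>. So \<open>d\<close> takes no value strictly between \<open>p\<close> and
    \<open>\<alpha>\<close> to the right of \<open>\<alpha>\<close>.\<close>
  have d_hit: "y \<in> {\<alpha>..1}" if "\<alpha> \<in> {p..1}" "d \<alpha> \<le> y" "p < y" "y \<le> 1" for \<alpha> y
  proof -
    have "\<exists>x\<ge>\<alpha>. x \<le> 1 \<and> d x = y"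
      using that p d1 by (intro IVT' d_cont) auto
    then obtain x where "\<alpha> \<le> x" "x \<le> 1" "d x = y" by blast
    then show ?thesis using d_eq[of x] that by auto
  qed
  have d_id: "d \<alpha> = \<alpha>" if \<alpha>: "\<alpha> \<in> {p..1}" for \<alpha>
  proof (rule ccontr)
    assume "d \<alpha> \<noteq> \<alpha>"
    moreover have "d \<alpha> \<le> p" using d_eq[OF \<alpha>] calculation by force
    ultimately have less: "d \<alpha> < \<alpha>" using d_le[of \<alpha>] \<alpha> p by auto
    show False
    proof (cases "\<alpha> = p")
      case False
      then show False using d_hit[OF \<alpha>, of "(p + \<alpha>) / 2"] \<open>d \<alpha> \<le> p\<close> \<alpha> by auto
    next
      case True
      \<comment> \<open>At \<open>\<alpha> = p\<close> there is no room between \<open>p\<close> and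
        \<open>\<alpha>\<close>; a point \<open>x > p\<close> with \<open>d x < p\<close> is found
        first, and the argument of the other case applies to it.\<close>
      then have "\<exists>x\<ge>p. x \<le> 1 \<and> d x = (d p + p) / 2"
        using less d1 d_cont[of p] p by (intro IVT') auto
      then obtain x where x: "p \<le> x" "x \<le> 1" "d x = (d p + p) / 2" by blast
      have "d x < p" using x less True by simp
      then have "x \<noteq> p" "d x \<le> p" "d x \<noteq> x" using x less True by auto
      then show False using d_hit[of x "(p + x) / 2"] x by auto
    qed
  qed
  have C_diag: "C w w = w" if "0 \<le> w" "w \<le> 1 - p" for w
    using d_id[of "1 - w"] that p by (simp add: d_def)
  have C_min: "C u v = min u v" if "u \<in> {0..1}" "v \<in> {0..1}" "min u v \<le> 1 - p" for u v
  proof -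
    have "C (min u v) (min u v) \<le> C u v" using that by (intro copula_mono_Lipschitz[OF C]) auto
    then show ?thesis using C_diag[of "min u v"] bounds[of u v] that by auto
  qed

  \<comment> \<open>For events of probabilities \<open>p\<close> and \<open>e\<close> the copula now
    forces the full overlap \<open>e\<close>; the competitor is a disjoint pair.\<close>
  have step: "h (p + e) - h p \<le> h e" if "0 \<le> e" "e \<le> p" "p + e \<le> 1" for e
    using max[of p e 0] C_min[of "1 - p" "1 - e"] that p h01 by (auto simp: min_def)
  have slopes: "(h s - h p) / (s - p) \<le> (h t - h 0) / (t - 0)" if "s \<in> {p<..1}" "t \<in> {0<..p}" for s t
  proof -
    \<comment> \<open>Shortening makes chords from \<open>p\<close> steeper and chords from 0
      flatter, so it suffices to compare them at a common length to which \<open>step\<close>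
      applies.\<close>
    define e where "e = min (s - p) t"
    have e: "0 < e" "e \<le> t" "p + e \<le> s" using that by (auto simp: e_def)
    have "(h s - h p) / (s - p) \<le> (h (p + e) - h p) / (p + e - p)"
      using convex_on_slope_mono[OF conc, of "p + e" s] e that by (simp add: divide_simps algebra_simps)
    also have "\<dots> \<le> (h e - h 0) / (e - 0)"
      using step[of e] e that h01 by (simp add: divide_right_mono)
    also have "\<dots> \<le> (h t - h 0) / (t - 0)"
      using convex_on_slope_mono[OF conv, of e t] e that by simp
    finally show ?thesis .
  qed
  then show "\<forall>s\<in>{p<..1}. \<forall>t\<in>{0<..p}. (h s - h p) / (s - p) \<le> (h t - h 0) / (t - 0)" by blast

  have C_tail: "C u v = max (u + v - 1) (1 - p)"
    if uv: "u \<in> {0..1}" "v \<in> {0..1}" "1 - p < u" "1 - p < v" for u v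
  proof -
    \<comment> \<open>\<open>g\<close> is the least overlap for which the union has probability at
      most \<open>p\<close>; \<open>\<gamma>\<close> is the overlap under \<open>C\<close>.\<close>
    define \<alpha> \<beta> \<gamma> g where "\<alpha> = 1 - u" and "\<beta> = 1 - v" and "\<gamma> = \<alpha> + \<beta> - 1 + C u v"
      and "g = Max {0, \<alpha> + \<beta> - p}"
    have ab: "\<alpha> \<in> {0..<p}" "\<beta> \<in> {0..<p}" using uv p by (auto simp: \<alpha>_def \<beta>_def)
    have \<gamma>: "0 \<le> \<gamma>" "\<gamma> \<le> \<alpha>" "\<gamma> \<le> \<beta>" using bounds[OF uv(1,2)] by (auto simp: \<gamma>_def \<alpha>_def \<beta>_def)
    have g: "0 \<le> g" "\<alpha> + \<beta> - p \<le> g" "g \<le> \<alpha>" "g \<le> \<beta>" "g = 0 \<or> g = \<alpha> + \<beta> - p"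
      using ab by (auto simp: g_def)
    have le: "h g + h (\<alpha> + \<beta> - g) \<le> h \<gamma> + h (\<alpha> + \<beta> - \<gamma>)"
      using max[of \<alpha> \<beta> g] g ab p by (auto simp: \<gamma>_def \<alpha>_def \<beta>_def algebra_simps)
    have "\<not> g < \<gamma>"
    proof
      assume "g < \<gamma>"
      \<comment> \<open>Both pairs lie in \<open>[0, p]\<close>, where strict convexity favours the
        more widely spread one.\<close>
      then have "h \<gamma> + h (\<alpha> + \<beta> - \<gamma>) < h g + h (\<alpha> + \<beta> - g)"
        using g \<gamma> ab by (intro ex1) auto
      with le show False by simp
    qed
    moreover have "\<not> \<gamma> < g"
    proof
      assume less: "\<gamma> < g"
      then have gp: "g = \<alpha> + \<beta> - p" using g \<gamma> by auto
      define \<delta> where "\<delta> = g - \<gamma>"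
      have \<delta>: "0 < \<delta>" "p + \<delta> = \<alpha> + \<beta> - \<gamma>" "p + \<delta> \<le> 1" "\<delta> \<le> p"
        using less gp \<gamma> ab bounds[OF uv(1,2)] p by (auto simp: \<delta>_def \<gamma>_def \<alpha>_def \<beta>_def)
      \<comment> \<open>The slope comparison is weak; halving \<open>\<delta>\<close> brings in the
        strict concavity. The chain shows that the part \<open>\<delta>\<close> of the union above
        \<open>p\<close> is worth less than raising the overlap from \<open>\<gamma>\<close> to
        \<open>g\<close>.\<close>
      have "- h (p + \<delta> / 2) + - h (p + \<delta> / 2) < - h p + - h (p + \<delta>)"
        using \<delta> p by (intro ex2) auto
      then have "h (p + \<delta>) - h p < 2 * (h (p + \<delta> / 2) - h p)" by simp
      also have "\<dots> \<le> h \<delta>"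
        using slopes[of "p + \<delta> / 2" \<delta>] \<delta> h01 by (simp add: divide_simps)
      also have "\<dots> \<le> h g - h \<gamma>"
        using convex_on_exchange[OF conv, of 0 g \<gamma> \<delta>] \<gamma> g ab less h01 by (auto simp: \<delta>_def)
      finally show False using le gp \<delta> by simp
    qed
    ultimately have "\<gamma> = g" by simp
    then show ?thesis by (auto simp: g_def \<gamma>_def \<alpha>_def \<beta>_def max_def split: if_splits)
  qed
  show "\<forall>u\<in>{0..1}. \<forall>v\<in>{0..1}. C u v = C_pm p u v"
    using C_min C_tail by (auto simp: C_pm_def)
qed

section \<open>Tail means\<close>

definition survival :: "'a measure \<Rightarrow> ('a \<Rightarrow> real) \<Rightarrow> real \<Rightarrow> real" where
  "survival M Z x = measure M {\<omega> \<in> space M. x < Z \<omega>}"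

text \<open>This is \<open>\<alpha>\<close> times the expected shortfall at level \<open>1 - \<alpha>\<close>, the unnormalised distorted
  expectation of \<open>t \<mapsto> min t \<alpha>\<close>.\<close>

definition tail_mean :: "'a measure \<Rightarrow> real \<Rightarrow> ('a \<Rightarrow> real) \<Rightarrow> real" where
  "tail_mean M \<alpha> Z = (\<integral>x. min (survival M Z x) \<alpha> - \<alpha> * indicator {..<0} x \<partial>lborel)"

lemma integrable_lborel_bounded_support:
  fixes f :: "real \<Rightarrow> real"
  assumes "f \<in> borel_measurable borel" and "\<And>x. \<bar>f x\<bar> \<le> c" and "\<And>x. x \<notin> {-L..L} \<Longrightarrow> f x = 0"
  shows "integrable lborel f"
proof (rule Bochner_Integration.integrable_bound)
  show "integrable lborel (\<lambda>x. c * indicator {-L..L} x :: real)"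
    by (intro integrable_mult_right integrable_real_indicator) (auto simp: emeasure_lborel_Icc_eq)
  have "norm (f x) \<le> norm (c * indicator {-L..L} x)" for x
    using assms(2)[of x] assms(3)[of x] by (cases "x \<in> {-L..L}") auto
  then show "AE x in lborel. norm (f x) \<le> norm (c * indicator {-L..L} x)" by simp
qed (use assms in auto)

lemma integrable_indicator_shift [simp, intro]:
  fixes k :: real
  shows "integrable lborel (\<lambda>s. indicator {..k} s - indicator {..<0} s :: real)"
  by (rule integrable_lborel_bounded_support[of _ 1 "\<bar>k\<bar>"]) (auto simp: indicator_def)

text \<open>The signed length of the interval from 0 to \<open>k\<close>; it turns a shift of the
  origin in \<open>tail_mean\<close> into a multiple of \<open>k\<close>.\<close>

lemma integral_indicator_shift:
  "(\<integral>s. indicator {..k} s - indicator {..<0} s \<partial>lborel) = (k :: real)"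
proof (cases "0 \<le> k")
  case True
  then have "(\<lambda>s. indicator {..k} s - indicator {..<0} s :: real) = indicator {0..k}"
    by (auto simp: indicator_def fun_eq_iff)
  then show ?thesis using True by simp
next
  case False
  then have "(\<lambda>s. indicator {..k} s - indicator {..<0} s :: real) = (\<lambda>s. - indicator {k<..<0} s)"
    by (auto simp: indicator_def fun_eq_iff)
  then show ?thesis using False by simp
qed

section \<open>Survival functions and quantiles\<close>

context prob_space
begin

abbreviation bounded_rv :: "real \<Rightarrow> ('a \<Rightarrow> real) \<Rightarrow> bool" where
  "bounded_rv L Z \<equiv> Z \<in> borel_measurable M \<and> (\<forall>\<omega>\<in>space M. \<bar>Z \<omega>\<bar> \<le> L)"

lemma bounded_rv_integrable: "bounded_rv L Z \<Longrightarrow> integrable M Z"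
  by (intro integrable_const_bound[of _ L]) auto

lemma bounded_rv_integrable_excess:
  assumes "bounded_rv L Z"
  shows "integrable M (\<lambda>\<omega>. max 0 (Z \<omega> - k))"
  using bounded_rv_integrable[OF assms]
  by (intro Bochner_Integration.integrable_max Bochner_Integration.integrable_diff) auto

lemma survival_antimono: "Z \<in> borel_measurable M \<Longrightarrow> x \<le> y \<Longrightarrow> survival M Z y \<le> survival M Z x"
  unfolding survival_def by (intro finite_measure_mono) auto

lemma survival_measurable:
  assumes "Z \<in> borel_measurable M" shows "survival M Z \<in> borel_measurable borel"
proof -
  have "(\<lambda>x. - survival M Z x) \<in> borel_measurable borel"
    using survival_antimono[OF assms] by (intro borel_measurable_mono monoI) auto
  then have "(\<lambda>x. - (- survival M Z x)) \<in> borel_measurable borel" by (rule borel_measurable_uminus)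
  then show ?thesis by simp
qed

lemma survival_bounds: "0 \<le> survival M Z x" "survival M Z x \<le> 1"
  unfolding survival_def by auto

lemma survival_eq_0: "bounded_rv L Z \<Longrightarrow> L \<le> x \<Longrightarrow> survival M Z x = 0"
proof -
  assume "bounded_rv L Z" "L \<le> x"
  then have "{\<omega> \<in> space M. x < Z \<omega>} = {}" by (force simp: abs_le_iff)
  then show ?thesis by (simp only: survival_def measure_empty)
qed

lemma survival_eq_1: "bounded_rv L Z \<Longrightarrow> x < -L \<Longrightarrow> survival M Z x = 1"
proof -
  assume "bounded_rv L Z" "x < -L"
  then have "{\<omega> \<in> space M. x < Z \<omega>} = space M" by (force simp: abs_le_iff)
  then show ?thesis by (simp add: survival_def prob_space)
qed

lemma eq_in_law_survival:
  assumes "eq_in_law M X' X" "X \<in> borel_measurable M" "X' \<in> borel_measurable M"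
  shows "survival M X' = survival M X"
proof
  fix x
  have *: "survival M Z x = measure (distr M borel Z) {x<..}" if "Z \<in> borel_measurable M" for Z
    using that by (subst measure_distr) (auto simp: survival_def intro!: arg_cong[where f = prob])
  show "survival M X' x = survival M X x"
    using assms by (simp add: * eq_in_law_def)
qed

text \<open>\<open>q\<close> is an infimum of points with survival probability at most
  \<open>\<alpha>\<close>; the two inequalities are the limits from the right and from the left, and
  together they allow for an atom at \<open>q\<close>.\<close>

lemma quantile_exists:
  assumes Z: "bounded_rv L Z" and \<alpha>: "\<alpha> \<in> {0..1}"
  obtains q where "survival M Z q \<le> \<alpha>" "\<alpha> \<le> prob {\<omega> \<in> space M. q \<le> Z \<omega>}"
proof -
  \<comment> \<open>Starting at \<open>-L\<close> keeps the set bounded below also for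
    \<open>\<alpha> = 1\<close>, where every point satisfies the inequality.\<close>
  define G where "G = {x \<in> {-L..}. survival M Z x \<le> \<alpha>}"
  have [measurable]: "Z \<in> borel_measurable M" using Z by simp
  have L: "0 \<le> L" using Z not_empty by (auto intro: order_trans[OF abs_ge_zero])
  have ne: "L \<in> G" using survival_eq_0[OF Z] \<alpha> L by (auto simp: G_def)
  have bdd: "bdd_below G" by (auto simp: G_def)
  define q where "q = Inf G"
  have S_le: "survival M Z x \<le> \<alpha>" if "q < x" for x
  proof -
    have "\<exists>y\<in>G. y < x" using that ne bdd unfolding q_def by (subst (asm) cInf_less_iff) auto
    then obtain y where "y \<in> G" "y < x" by blast
    then show ?thesis using survival_antimono[of Z y x] Z by (auto simp: G_def)
  qed
  have S_ge: "\<alpha> \<le> survival M Z x" if "x < q" for x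
  proof (cases "x < -L")
    case True
    then show ?thesis using survival_eq_1[OF Z] \<alpha> by auto
  next
    case False
    have "x \<notin> G" using that cInf_lower[OF _ bdd, of x] by (auto simp: q_def)
    then show ?thesis using False by (auto simp: G_def)
  qed
  have dec: "1 / real (Suc (Suc n)) \<le> 1 / real (Suc n)" for n by (intro divide_left_mono) auto
  have inc: "{\<omega> \<in> space M. q + 1 / real (Suc n) < Z \<omega>} \<subseteq> {\<omega> \<in> space M. q + 1 / real (Suc (Suc n)) < Z \<omega>}"
    "{\<omega> \<in> space M. q - 1 / real (Suc (Suc n)) < Z \<omega>} \<subseteq> {\<omega> \<in> space M. q - 1 / real (Suc n) < Z \<omega>}" for n
    using dec[of n] by (intro Collect_mono impI conjI; linarith)+
  have "(\<lambda>n. prob {\<omega> \<in> space M. q + 1 / real (Suc n) < Z \<omega>}) \<longlonglongrightarrow>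
      prob (\<Union>n. {\<omega> \<in> space M. q + 1 / real (Suc n) < Z \<omega>})"
    by (intro finite_Lim_measure_incseq incseq_SucI inc) (rule image_subsetI, measurable)
  moreover have "(\<Union>n. {\<omega> \<in> space M. q + 1 / real (Suc n) < Z \<omega>}) = {\<omega> \<in> space M. q < Z \<omega>}"
  proof safe
    fix \<omega> assume "\<omega> \<in> space M" "q < Z \<omega>"
    then obtain n where "1 / real (Suc n) < Z \<omega> - q" using nat_approx_posE[of "Z \<omega> - q"] by auto
    then show "\<omega> \<in> (\<Union>n. {\<omega> \<in> space M. q + 1 / real (Suc n) < Z \<omega>})"
      using \<open>\<omega> \<in> space M\<close> by (auto intro!: exI[of _ n])
  qed (auto elim: order_less_trans[rotated])
  ultimately have "survival M Z q \<le> \<alpha>"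
    unfolding survival_def by (intro LIMSEQ_le_const2[of _ _ \<alpha>])
      (auto intro!: S_le[unfolded survival_def])
  moreover have "(\<lambda>n. prob {\<omega> \<in> space M. q - 1 / real (Suc n) < Z \<omega>}) \<longlonglongrightarrow>
      prob (\<Inter>n. {\<omega> \<in> space M. q - 1 / real (Suc n) < Z \<omega>})"
    by (intro finite_Lim_measure_decseq decseq_SucI inc) (rule image_subsetI, measurable)
  moreover have "(\<Inter>n. {\<omega> \<in> space M. q - 1 / real (Suc n) < Z \<omega>}) = {\<omega> \<in> space M. q \<le> Z \<omega>}"
  proof safe
    fix \<omega> assume *: "\<omega> \<in> (\<Inter>n. {\<omega> \<in> space M. q - 1 / real (Suc n) < Z \<omega>})"
    show "q \<le> Z \<omega>"
    proof (rule ccontr)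
      assume "\<not> q \<le> Z \<omega>"
      then obtain n where "1 / real (Suc n) < q - Z \<omega>" using nat_approx_posE[of "q - Z \<omega>"] by auto
      moreover have "q - 1 / real (Suc n) < Z \<omega>" using * by auto
      ultimately show False by simp
    qed
  qed (auto intro: less_le_trans[rotated])
  ultimately have "\<alpha> \<le> prob {\<omega> \<in> space M. q \<le> Z \<omega>}"
    by (intro LIMSEQ_le_const[of _ _ \<alpha>]) (auto intro!: S_ge[unfolded survival_def])
  with \<open>survival M Z q \<le> \<alpha>\<close> show thesis by (rule that)
qed

lemma survival_ge_below:
  assumes "Z \<in> borel_measurable M" "x < q" shows "prob {\<omega> \<in> space M. q \<le> Z \<omega>} \<le> survival M Z x"
  unfolding survival_def using assms by (intro finite_measure_mono) auto

section \<open>Expectations as integrals of probabilities\<close>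

lemma Fubini_bounded_support:
  fixes K :: "'a \<Rightarrow> real \<Rightarrow> real"
  assumes K [measurable]: "(\<lambda>(\<omega>, s). K \<omega> s) \<in> borel_measurable (M \<Otimes>\<^sub>M lborel)"
    and K01: "\<And>\<omega> s. \<omega> \<in> space M \<Longrightarrow> \<bar>K \<omega> s\<bar> \<le> 1"
    and K0: "\<And>\<omega> s :: real. \<omega> \<in> space M \<Longrightarrow> s \<notin> {-L..L} \<Longrightarrow> K \<omega> s = (0 :: real)"
  shows "integrable lborel (\<lambda>s. \<integral>\<omega>. K \<omega> s \<partial>M)"
    and "(\<integral>s. (\<integral>\<omega>. K \<omega> s \<partial>M) \<partial>lborel) = (\<integral>\<omega>. (\<integral>s. K \<omega> s \<partial>lborel) \<partial>M)"
proof -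
  interpret pair_sigma_finite M "lborel :: real measure" ..
  have "emeasure (M \<Otimes>\<^sub>M lborel) (space M \<times> {-L..L}) = emeasure M (space M) * emeasure lborel {-L..L}"
    by (rule lborel.emeasure_pair_measure_Times) auto
  also have "\<dots> < \<infinity>" by (simp add: emeasure_space_1 ennreal_mult_less_top emeasure_lborel_Icc_eq)
  finally have fin: "integrable (M \<Otimes>\<^sub>M lborel) (indicator (space M \<times> {-L..L}) :: _ \<Rightarrow> real)"
    by (intro integrable_real_indicator) auto
  have int: "integrable (M \<Otimes>\<^sub>M lborel) (\<lambda>(\<omega>, s). K \<omega> s)"
  proof (rule Bochner_Integration.integrable_bound[OF fin K], rule AE_I2)
    fix z assume "z \<in> space (M \<Otimes>\<^sub>M (lborel :: real measure))"
    then show "norm (case z of (\<omega>, s) \<Rightarrow> K \<omega> s) \<le> norm (indicator (space M \<times> {-L..L}) z :: real)"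
      using K01 K0 by (cases z) (force simp: space_pair_measure indicator_def)
  qed
  show "integrable lborel (\<lambda>s. \<integral>\<omega>. K \<omega> s \<partial>M)" by (rule integrable_snd[OF int])
  show "(\<integral>s. (\<integral>\<omega>. K \<omega> s \<partial>M) \<partial>lborel) = (\<integral>\<omega>. (\<integral>s. K \<omega> s \<partial>lborel) \<partial>M)"
    by (rule Fubini_integral[OF int])
qed

text \<open>Fubini, applied to the length of the interval from \<open>A \<omega>\<close> to
  \<open>B \<omega>\<close>. With \<open>A = k - Y\<close> and \<open>B = X\<close> it yields the
  excess of \<open>X + Y\<close> over \<open>k\<close>, with constant \<open>A\<close> that of a
  single variable.\<close>

lemma integral_prob_between:
  assumes "bounded_rv L A" "bounded_rv L B"
  shows "integrable lborel (\<lambda>s. prob {\<omega> \<in> space M. A \<omega> < s \<and> s < B \<omega>})"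
    and "(\<integral>s. prob {\<omega> \<in> space M. A \<omega> < s \<and> s < B \<omega>} \<partial>lborel) = (\<integral>\<omega>. max 0 (B \<omega> - A \<omega>) \<partial>M)"
proof -
  have [measurable]: "A \<in> borel_measurable M" "B \<in> borel_measurable M" using assms by auto
  define K where "K \<omega> s = (if A \<omega> < s \<and> s < B \<omega> then 1 else 0 :: real)" for \<omega> s
  have K: "(\<lambda>(\<omega>, s). K \<omega> s) \<in> borel_measurable (M \<Otimes>\<^sub>M lborel)" unfolding K_def by measurable
  have 1: "(\<integral>\<omega>. K \<omega> s \<partial>M) = prob {\<omega> \<in> space M. A \<omega> < s \<and> s < B \<omega>}" for s
  proof -
    have "(\<integral>\<omega>. K \<omega> s \<partial>M) = (\<integral>\<omega>. indicator {\<omega> \<in> space M. A \<omega> < s \<and> s < B \<omega>} \<omega> \<partial>M)"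
      by (intro Bochner_Integration.integral_cong) (auto simp: K_def)
    then show ?thesis by simp
  qed
  have 2: "(\<integral>s. K \<omega> s \<partial>lborel) = max 0 (B \<omega> - A \<omega>)" for \<omega>
  proof -
    have "K \<omega> = indicator {A \<omega><..<B \<omega>}" by (auto simp: K_def indicator_def)
    then show ?thesis by (cases "A \<omega> \<le> B \<omega>") auto
  qed
  have bd: "\<bar>K \<omega> s\<bar> \<le> 1" "s \<notin> {-L..L} \<Longrightarrow> K \<omega> s = 0" if "\<omega> \<in> space M" for \<omega> s
    using assms that by (force simp: K_def abs_le_iff)+
  show "integrable lborel (\<lambda>s. prob {\<omega> \<in> space M. A \<omega> < s \<and> s < B \<omega>})"
    using Fubini_bounded_support(1)[OF K bd] by (simp only: 1)
  show "(\<integral>s. prob {\<omega> \<in> space M. A \<omega> < s \<and> s < B \<omega>} \<partial>lborel) = (\<integral>\<omega>. max 0 (B \<omega> - A \<omega>) \<partial>M)"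
    using Fubini_bounded_support(2)[OF K bd] by (simp only: 1 2)
qed

text \<open>The inequalities are weak here because, for \<open>A = X\<close> and
  \<open>B = k - Y\<close>, they describe the complements of the strict tail events in
  \<open>survival\<close>.\<close>

lemma integral_weight_between:
  assumes "bounded_rv L A" "bounded_rv L B" and w: "w \<in> borel_measurable M" "\<And>\<omega>. w \<omega> \<in> {0..1}"
  shows "integrable lborel (\<lambda>s. \<integral>\<omega>. w \<omega> * (if A \<omega> \<le> s \<and> s \<le> B \<omega> then 1 else 0) \<partial>M)"
    and "(\<integral>s. (\<integral>\<omega>. w \<omega> * (if A \<omega> \<le> s \<and> s \<le> B \<omega> then 1 else 0) \<partial>M) \<partial>lborel)
       = (\<integral>\<omega>. w \<omega> * max 0 (B \<omega> - A \<omega>) \<partial>M)"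
proof -
  have [measurable]: "A \<in> borel_measurable M" "B \<in> borel_measurable M" "w \<in> borel_measurable M"
    using assms by auto
  define K where "K \<omega> s = w \<omega> * (if A \<omega> \<le> s \<and> s \<le> B \<omega> then 1 else 0 :: real)" for \<omega> s
  have K: "(\<lambda>(\<omega>, s). K \<omega> s) \<in> borel_measurable (M \<Otimes>\<^sub>M lborel)" unfolding K_def by measurable
  have 2: "(\<integral>s. K \<omega> s \<partial>lborel) = w \<omega> * max 0 (B \<omega> - A \<omega>)" for \<omega>
  proof -
    have "K \<omega> = (\<lambda>s. w \<omega> * indicator {A \<omega>..B \<omega>} s)" by (auto simp: K_def indicator_def)
    then show ?thesis by (cases "A \<omega> \<le> B \<omega>") auto
  qed
  have bd: "\<bar>K \<omega> s\<bar> \<le> 1" "s \<notin> {-L..L} \<Longrightarrow> K \<omega> s = 0" if "\<omega> \<in> space M" for \<omega> s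
    using assms that w(2)[of \<omega>] by (force simp: K_def abs_le_iff)+
  show "integrable lborel (\<lambda>s. \<integral>\<omega>. w \<omega> * (if A \<omega> \<le> s \<and> s \<le> B \<omega> then 1 else 0) \<partial>M)"
    using Fubini_bounded_support(1)[OF K bd] by (simp only: K_def)
  show "(\<integral>s. (\<integral>\<omega>. w \<omega> * (if A \<omega> \<le> s \<and> s \<le> B \<omega> then 1 else 0) \<partial>M) \<partial>lborel)
       = (\<integral>\<omega>. w \<omega> * max 0 (B \<omega> - A \<omega>) \<partial>M)"
    using Fubini_bounded_support(2)[OF K bd] unfolding 2 unfolding K_def .
qed

lemma integral_excess:
  assumes Z: "bounded_rv L Z"
  shows "integrable lborel (\<lambda>s. indicator {k<..} s * survival M Z s)"
    and "(\<integral>s. indicator {k<..} s * survival M Z s \<partial>lborel) = (\<integral>\<omega>. max 0 (Z \<omega> - k) \<partial>M)"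
proof -
  have "prob {\<omega> \<in> space M. k < s \<and> s < Z \<omega>} = indicator {k<..} s * survival M Z s" for s
    by (cases "k < s") (auto simp: survival_def)
  moreover have "bounded_rv (max L \<bar>k\<bar>) (\<lambda>_. k)" "bounded_rv (max L \<bar>k\<bar>) Z" using Z by auto
  note integral_prob_between[OF this]
  ultimately show "integrable lborel (\<lambda>s. indicator {k<..} s * survival M Z s)"
    "(\<integral>s. indicator {k<..} s * survival M Z s \<partial>lborel) = (\<integral>\<omega>. max 0 (Z \<omega> - k) \<partial>M)"
    by simp_all
qed

lemma integrable_tail_mean:
  assumes Z: "bounded_rv L Z" and \<alpha>: "\<alpha> \<in> {0..1}"
  shows "integrable lborel (\<lambda>x. min (survival M Z x) \<alpha> - \<alpha> * indicator {..<0} x)"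
proof (rule integrable_lborel_bounded_support[of _ 1 L])
  have [measurable]: "survival M Z \<in> borel_measurable borel" using Z survival_measurable by blast
  show "(\<lambda>x. min (survival M Z x) \<alpha> - \<alpha> * indicator {..<0} x) \<in> borel_measurable borel"
    by measurable
  show "\<bar>min (survival M Z x) \<alpha> - \<alpha> * indicator {..<0} x\<bar> \<le> 1" for x
    using \<alpha> survival_bounds[of Z x] by (auto simp: indicator_def min_def abs_le_iff)
  have L: "0 \<le> L" using Z not_empty by (auto intro: order_trans[OF abs_ge_zero])
  show "min (survival M Z x) \<alpha> - \<alpha> * indicator {..<0} x = 0" if "x \<notin> {-L..L}" for x
    using survival_eq_0[OF Z, of x] survival_eq_1[OF Z, of x] that \<alpha> L
    by (cases "x < -L") auto
qed

section \<open>The variational formula for tail means\<close>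

text \<open>The integrand \<open>min (survival M Z s) \<alpha>\<close> is bounded by
  \<open>\<alpha>\<close> up to \<open>k\<close> and by the survival function beyond. With
  \<open>tail_mean_eq\<close> this is the Rockafellar-Uryasev formula for expected
  shortfall.\<close>

lemma tail_mean_le:
  assumes Z: "bounded_rv L Z" and \<alpha>: "\<alpha> \<in> {0..1}"
  shows "tail_mean M \<alpha> Z \<le> \<alpha> * k + (\<integral>\<omega>. max 0 (Z \<omega> - k) \<partial>M)"
proof -
  have "tail_mean M \<alpha> Z \<le> (\<integral>s. \<alpha> * (indicator {..k} s - indicator {..<0} s)
      + indicator {k<..} s * survival M Z s \<partial>lborel)"
    unfolding tail_mean_def
  proof (rule integral_mono)
    fix s :: real
    show "min (survival M Z s) \<alpha> - \<alpha> * indicator {..<0} s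
        \<le> \<alpha> * (indicator {..k} s - indicator {..<0} s) + indicator {k<..} s * survival M Z s"
      using \<alpha> survival_bounds(1)[of Z s] by (auto simp: indicator_def min_def)
  qed (auto intro!: integrable_tail_mean[OF Z \<alpha>] integral_excess[OF Z])
  also have "\<dots> = \<alpha> * k + (\<integral>\<omega>. max 0 (Z \<omega> - k) \<partial>M)"
    by (subst Bochner_Integration.integral_add)
      (auto simp: integral_indicator_shift integral_excess[OF Z])
  finally show ?thesis .
qed

text \<open>At a quantile the survival function crosses the level \<open>\<alpha>\<close>, so both
  bounds behind \<open>tail_mean_le\<close> are exact away from the null set containing
  \<open>q\<close>.\<close>

lemma tail_mean_eq:
  assumes Z: "bounded_rv L Z" and \<alpha>: "\<alpha> \<in> {0..1}"
    and q: "survival M Z q \<le> \<alpha>" "\<alpha> \<le> prob {\<omega> \<in> space M. q \<le> Z \<omega>}"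
  shows "tail_mean M \<alpha> Z = \<alpha> * q + (\<integral>\<omega>. max 0 (Z \<omega> - q) \<partial>M)"
proof -
  have Zm: "Z \<in> borel_measurable M" using Z by simp
  have [measurable]: "survival M Z \<in> borel_measurable borel" using survival_measurable[OF Zm] .
  have "tail_mean M \<alpha> Z = (\<integral>s. \<alpha> * (indicator {..q} s - indicator {..<0} s)
      + indicator {q<..} s * survival M Z s \<partial>lborel)"
    unfolding tail_mean_def
  proof (rule integral_cong_AE)
    show "AE s in lborel. min (survival M Z s) \<alpha> - \<alpha> * indicator {..<0} s
        = \<alpha> * (indicator {..q} s - indicator {..<0} s) + indicator {q<..} s * survival M Z s"
      using AE_lborel_singleton[of q]
    proof eventually_elim
      case (elim s)
      show ?case
      proof (cases "s < q")
        case True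
        then show ?thesis using survival_ge_below[OF Zm True] q(2) by (auto simp: indicator_def)
      next
        case False
        then show ?thesis using survival_antimono[OF Zm, of q s] q(1) elim by (auto simp: indicator_def)
      qed
    qed
  qed measurable
  also have "\<dots> = \<alpha> * q + (\<integral>\<omega>. max 0 (Z \<omega> - q) \<partial>M)"
    by (subst Bochner_Integration.integral_add)
      (auto simp: integral_indicator_shift integral_excess[OF Z])
  finally show ?thesis .
qed

text \<open>The substitution of \<open>k - s\<close> in the tail mean of \<open>Y\<close> puts both
  variables on the axis used in the formula for the excess of \<open>X + Y\<close>; the corrections
  at 0 then combine into \<open>\<alpha> * k\<close>.\<close>

lemma tail_mean_add_eq_integral:
  assumes X: "bounded_rv L X" and Y: "bounded_rv L Y" and \<alpha>: "\<alpha> \<in> {0..1}"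
  shows "integrable lborel (\<lambda>s. min (survival M X s) \<alpha> + min (survival M Y (k - s)) \<alpha> - \<alpha>)"
    and "tail_mean M \<alpha> X + tail_mean M \<alpha> Y - \<alpha> * k
      = (\<integral>s. min (survival M X s) \<alpha> + min (survival M Y (k - s)) \<alpha> - \<alpha> \<partial>lborel)"
proof -
  define f where "f Z x = min (survival M Z x) \<alpha> - \<alpha> * indicator {..<0} x" for Z x
  have f: "integrable lborel (f X)" "integrable lborel (f Y)"
    unfolding f_def using integrable_tail_mean X Y \<alpha> by auto
  have fY: "integrable lborel (\<lambda>s. f Y (k + (-1) * s))"
    using f(2) by (rule lborel_integrable_real_affine) simp
  have *: "min (survival M X s) \<alpha> + min (survival M Y (k - s)) \<alpha> - \<alpha>
      = f X s + f Y (k + (-1) * s) - \<alpha> * (indicator {..k} s - indicator {..<0} s)" for s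
    by (auto simp: f_def indicator_def algebra_simps)
  show "integrable lborel (\<lambda>s. min (survival M X s) \<alpha> + min (survival M Y (k - s)) \<alpha> - \<alpha>)"
    unfolding * using f fY by (intro Bochner_Integration.integrable_diff Bochner_Integration.integrable_add) auto
  have "tail_mean M \<alpha> Y = (\<integral>s. f Y (k + (-1) * s) \<partial>lborel)"
    unfolding tail_mean_def f_def[symmetric] by (subst lborel_integral_real_affine[of "-1" _ k]) auto
  moreover have "tail_mean M \<alpha> X = (\<integral>s. f X s \<partial>lborel)" by (simp add: tail_mean_def f_def)
  ultimately show "tail_mean M \<alpha> X + tail_mean M \<alpha> Y - \<alpha> * k
      = (\<integral>s. min (survival M X s) \<alpha> + min (survival M Y (k - s)) \<alpha> - \<alpha> \<partial>lborel)"
    unfolding * using f fY by (simp add: integral_indicator_shift)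
qed

text \<open>Evaluating the variational bound at the sum of quantiles \<open>a\<close> and
  \<open>b\<close> reduces the claim to subadditivity of the positive part.\<close>

lemma tail_mean_subadditive:
  assumes X: "bounded_rv L X" and Y: "bounded_rv L Y" and \<alpha>: "\<alpha> \<in> {0..1}"
  shows "tail_mean M \<alpha> (\<lambda>\<omega>. X \<omega> + Y \<omega>) \<le> tail_mean M \<alpha> X + tail_mean M \<alpha> Y"
proof -
  have [measurable]: "X \<in> borel_measurable M" "Y \<in> borel_measurable M" using X Y by auto
  have XY: "bounded_rv (2 * L) (\<lambda>\<omega>. X \<omega> + Y \<omega>)" using X Y by (force simp: abs_le_iff)
  obtain a where a: "survival M X a \<le> \<alpha>" "\<alpha> \<le> prob {\<omega> \<in> space M. a \<le> X \<omega>}"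
    using quantile_exists[OF X \<alpha>] .
  obtain b where b: "survival M Y b \<le> \<alpha>" "\<alpha> \<le> prob {\<omega> \<in> space M. b \<le> Y \<omega>}"
    using quantile_exists[OF Y \<alpha>] .
  have int: "integrable M (\<lambda>\<omega>. max 0 (X \<omega> - a))" "integrable M (\<lambda>\<omega>. max 0 (Y \<omega> - b))"
    "integrable M (\<lambda>\<omega>. max 0 (X \<omega> + Y \<omega> - (a + b)))"
    using X Y XY by (intro bounded_rv_integrable_excess; blast)+
  have "tail_mean M \<alpha> (\<lambda>\<omega>. X \<omega> + Y \<omega>) \<le> \<alpha> * (a + b) + (\<integral>\<omega>. max 0 (X \<omega> + Y \<omega> - (a + b)) \<partial>M)"
    by (rule tail_mean_le[OF XY \<alpha>])
  also have "(\<integral>\<omega>. max 0 (X \<omega> + Y \<omega> - (a + b)) \<partial>M) \<le> (\<integral>\<omega>. max 0 (X \<omega> - a) + max 0 (Y \<omega> - b) \<partial>M)"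
    using int by (intro integral_mono) auto
  also have "\<alpha> * (a + b) + (\<integral>\<omega>. max 0 (X \<omega> - a) + max 0 (Y \<omega> - b) \<partial>M)
      = tail_mean M \<alpha> X + tail_mean M \<alpha> Y"
    using int by (simp add: tail_mean_eq[OF X \<alpha> a] tail_mean_eq[OF Y \<alpha> b] algebra_simps)
  finally show ?thesis by simp
qed

lemma bounded_rv_add:
  assumes "bounded_rv L X" "bounded_rv L Y"
  shows "bounded_rv (2 * L) (\<lambda>\<omega>. X \<omega> + Y \<omega>)"
  using assms by (force simp: abs_le_iff)

section \<open>Tail means of sums and the extremal copula\<close>

text \<open>The excess over \<open>k\<close> is the length of the interval from \<open>k - Y\<close>
  to \<open>X\<close>, so its mean integrates the probability of \<open>X > s\<close> and
  \<open>Y > k - s\<close>; inclusion-exclusion expresses the latter by \<open>C\<close>.\<close>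

lemma integral_excess_add:
  assumes X: "bounded_rv L X" and Y: "bounded_rv L Y" and C: "copula_of M C X Y"
  shows "integrable lborel (\<lambda>s. survival M X s + survival M Y (k - s) - 1
      + C (1 - survival M X s) (1 - survival M Y (k - s)))" (is "integrable lborel ?f")
    and "(\<integral>s. survival M X s + survival M Y (k - s) - 1
      + C (1 - survival M X s) (1 - survival M Y (k - s)) \<partial>lborel) = (\<integral>\<omega>. max 0 (X \<omega> + Y \<omega> - k) \<partial>M)"
proof -
  have [measurable]: "X \<in> borel_measurable M" "Y \<in> borel_measurable M" using X Y by auto
  have cdf: "prob {\<omega> \<in> space M. Z \<omega> \<le> x} = 1 - survival M Z x" if [measurable]: "Z \<in> borel_measurable M" for Z x
  proof -
    have "{\<omega> \<in> space M. Z \<omega> \<le> x} = space M - {\<omega> \<in> space M. x < Z \<omega>}" by auto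
    then show ?thesis by (simp add: prob_compl survival_def)
  qed
  have eq: "prob {\<omega> \<in> space M. k - Y \<omega> < s \<and> s < X \<omega>} = ?f s" for s
  proof -
    let ?A = "{\<omega> \<in> space M. X \<omega> \<le> s}" and ?B = "{\<omega> \<in> space M. Y \<omega> \<le> k - s}"
    have "{\<omega> \<in> space M. k - Y \<omega> < s \<and> s < X \<omega>} = space M - (?A \<union> ?B)" by auto
    then have "prob {\<omega> \<in> space M. k - Y \<omega> < s \<and> s < X \<omega>} = 1 - prob (?A \<union> ?B)"
      by (simp add: prob_compl)
    also have "prob (?A \<union> ?B) = prob ?A + prob ?B - prob (?A \<inter> ?B)"
      by (rule measure_Un3) (auto simp: fmeasurable_eq_sets)
    also have "?A \<inter> ?B = {\<omega> \<in> space M. X \<omega> \<le> s \<and> Y \<omega> \<le> k - s}" by auto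
    also have "prob \<dots> = C (prob ?A) (prob ?B)" using C by (simp add: copula_of_def)
    finally show ?thesis by (simp add: cdf)
  qed
  have "bounded_rv (L + \<bar>k\<bar>) (\<lambda>\<omega>. k - Y \<omega>)" "bounded_rv (L + \<bar>k\<bar>) X"
    using X Y by (force simp: abs_le_iff)+
  note between = integral_prob_between[OF this, unfolded eq]
  show "integrable lborel ?f" by (rule between(1))
  have "X \<omega> - (k - Y \<omega>) = X \<omega> + Y \<omega> - k" for \<omega> by simp
  with between(2) show "(\<integral>s. ?f s \<partial>lborel) = (\<integral>\<omega>. max 0 (X \<omega> + Y \<omega> - k) \<partial>M)" by simp
qed

text \<open>At a quantile \<open>k\<close> of the sum both sides are integrals over
  \<open>s\<close>, compared pointwise. With \<open>tail_mean_subadditive\<close> this makes the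
  tail means at levels from \<open>p\<close> on additive under \<open>C\<close>, hence
  maximal.\<close>

lemma C_pm_tail_mean_superadditive:
  assumes X: "bounded_rv L X" and Y: "bounded_rv L Y" and C: "copula_of M C X Y"
    and C_pm: "\<forall>u\<in>{0..1}. \<forall>v\<in>{0..1}. C u v = C_pm p u v" and p: "p \<in> {0<..<1}" and \<alpha>: "\<alpha> \<in> {p..1}"
  shows "tail_mean M \<alpha> X + tail_mean M \<alpha> Y \<le> tail_mean M \<alpha> (\<lambda>\<omega>. X \<omega> + Y \<omega>)"
proof -
  have \<alpha>01: "\<alpha> \<in> {0..1}" using \<alpha> p by auto
  have XY: "bounded_rv (2 * L) (\<lambda>\<omega>. X \<omega> + Y \<omega>)" by (rule bounded_rv_add[OF X Y])
  obtain k where k: "survival M (\<lambda>\<omega>. X \<omega> + Y \<omega>) k \<le> \<alpha>"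
      "\<alpha> \<le> prob {\<omega> \<in> space M. k \<le> X \<omega> + Y \<omega>}"
    using quantile_exists[OF XY \<alpha>01] .
  \<comment> \<open>The right side is the joint survival probability: \<open>min x y\<close> if
    \<open>max x y \<ge> p\<close>, and \<open>max 0 (x + y - p)\<close> otherwise.\<close>
  have pointwise: "min x \<alpha> + min y \<alpha> - \<alpha> \<le> x + y - 1 + C (1 - x) (1 - y)"
    if "0 \<le> x" "x \<le> 1" "0 \<le> y" "y \<le> 1" for x y
    using that C_pm[rule_format, of "1 - x" "1 - y"] \<alpha> p
    by (auto simp: C_pm_def min_def max_def split: if_splits)
  have "tail_mean M \<alpha> X + tail_mean M \<alpha> Y - \<alpha> * k \<le> (\<integral>\<omega>. max 0 (X \<omega> + Y \<omega> - k) \<partial>M)"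
    unfolding tail_mean_add_eq_integral[OF X Y \<alpha>01] integral_excess_add(2)[OF X Y C, symmetric]
    by (intro integral_mono tail_mean_add_eq_integral(1)[OF X Y \<alpha>01] integral_excess_add(1)[OF X Y C]
        pointwise survival_bounds)
  then show ?thesis using tail_mean_eq[OF XY \<alpha>01 k] by simp
qed

text \<open>\<open>max 0 (p - survival M X s)\<close> is the distribution function of the upper tail
  of \<open>X\<close> of mass \<open>p\<close>. Hence this is the Frechet lower bound, for total
  mass \<open>p\<close>, on the joint distribution function of the two upper tails at
  \<open>(s, k - s)\<close>.\<close>

definition tail_gap :: "real \<Rightarrow> real \<Rightarrow> ('a \<Rightarrow> real) \<Rightarrow> ('a \<Rightarrow> real) \<Rightarrow> real \<Rightarrow> real" where
  "tail_gap p k X Y s = max 0 (max 0 (p - survival M X s) + max 0 (p - survival M Y (k - s)) - p)"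

lemma integrable_tail_gap:
  assumes X: "bounded_rv L X" and Y: "bounded_rv L Y" and p: "p \<in> {0<..<1}"
  shows "integrable lborel (tail_gap p k X Y)"
proof (rule integrable_lborel_bounded_support[of _ 1 "L + \<bar>k\<bar>"])
  have [measurable]: "survival M X \<in> borel_measurable borel" "survival M Y \<in> borel_measurable borel"
    using X Y survival_measurable by auto
  show "tail_gap p k X Y \<in> borel_measurable borel" unfolding tail_gap_def by measurable
  show "\<bar>tail_gap p k X Y s\<bar> \<le> 1" for s
    using p survival_bounds(1)[of X s] survival_bounds(1)[of Y "k - s"]
    by (auto simp: tail_gap_def max_def)
  show "tail_gap p k X Y s = 0" if "s \<notin> {- (L + \<bar>k\<bar>)..L + \<bar>k\<bar>}" for s
  proof (cases "s < - (L + \<bar>k\<bar>)")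
    case True
    then have "survival M X s = 1" by (intro survival_eq_1[OF X]) linarith
    then show ?thesis using p survival_bounds(1)[of Y "k - s"] by (auto simp: tail_gap_def max_def)
  next
    case False
    then have "survival M Y (k - s) = 1" using that by (intro survival_eq_1[OF Y]) auto
    then show ?thesis using p survival_bounds(1)[of X s] by (auto simp: tail_gap_def max_def)
  qed
qed

text \<open>The weight \<open>w\<close> cuts out the upper tail of \<open>X + Y\<close> of mass \<open>p\<close>; on it the Frechet lower
  bound for the joint distribution function gives the estimate, for every coupling.\<close>

lemma tail_mean_diff_excess_le:
  assumes X: "bounded_rv L X" and Y: "bounded_rv L Y" and p: "p \<in> {0<..<1}"
  shows "tail_mean M p (\<lambda>\<omega>. X \<omega> + Y \<omega>) - (\<integral>\<omega>. max 0 (X \<omega> + Y \<omega> - k) \<partial>M)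
    \<le> p * k - (\<integral>s. tail_gap p k X Y s \<partial>lborel)"
proof -
  have [measurable]: "X \<in> borel_measurable M" "Y \<in> borel_measurable M" using X Y by auto
  have p01: "p \<in> {0..1}" using p by auto
  define Z where "Z = (\<lambda>\<omega>. X \<omega> + Y \<omega>)"
  have Z: "bounded_rv (2 * L) Z" using X Y unfolding Z_def by (force simp: abs_le_iff)
  then have Zm [measurable]: "Z \<in> borel_measurable M" by simp
  obtain q where q: "survival M Z q \<le> p" "p \<le> prob {\<omega> \<in> space M. q \<le> Z \<omega>}"
    using quantile_exists[OF Z p01] .
  define m where "m = prob {\<omega> \<in> space M. Z \<omega> = q}"
  have m: "prob {\<omega> \<in> space M. q \<le> Z \<omega>} = survival M Z q + m"
  proof -
    have "{\<omega> \<in> space M. q \<le> Z \<omega>} = {\<omega> \<in> space M. q < Z \<omega>} \<union> {\<omega> \<in> space M. Z \<omega> = q}" by auto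
    moreover have "prob \<dots> = survival M Z q + m"
      unfolding survival_def m_def by (rule finite_measure_Union) auto
    ultimately show ?thesis by simp
  qed
  \<comment> \<open>The share of the atom at \<open>q\<close> that completes the tail to mass
    \<open>p\<close>. For \<open>m = 0\<close> division gives \<open>c = 0\<close>, and then
    \<open>q\<close> forces \<open>survival M Z q = p\<close>, so \<open>cm\<close> still
    holds.\<close>
  define c where "c = (p - survival M Z q) / m"
  have cm: "c * m = p - survival M Z q" using q m by (auto simp: c_def)
  have c: "c \<in> {0..1}"
    using q m measure_nonneg[of M "{\<omega> \<in> space M. Z \<omega> = q}"] by (auto simp: c_def m_def[symmetric] divide_le_eq)
  define w where "w \<omega> = (if q < Z \<omega> then 1 else if Z \<omega> = q then c else 0)" for \<omega>
  have w01: "w \<omega> \<in> {0..1}" for \<omega> using c by (auto simp: w_def)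
  have wm [measurable]: "w \<in> borel_measurable M" unfolding w_def by measurable
  have int_w: "integrable M w" using w01 by (intro integrable_const_bound[of _ 1]) auto
  have int_wf: "integrable M (\<lambda>\<omega>. w \<omega> * f \<omega>)" if f: "integrable M f" for f
  proof (rule Bochner_Integration.integrable_bound[OF f])
    show "AE \<omega> in M. norm (w \<omega> * f \<omega>) \<le> norm (f \<omega>)"
      using w01 by (auto simp: abs_mult intro!: mult_left_le_one_le)
  qed (use f in measurable)
  have Ew: "(\<integral>\<omega>. w \<omega> \<partial>M) = p"
  proof -
    have "(\<integral>\<omega>. w \<omega> \<partial>M) = (\<integral>\<omega>. indicator {\<omega> \<in> space M. q < Z \<omega>} \<omega> + c * indicator {\<omega> \<in> space M. Z \<omega> = q} \<omega> \<partial>M)"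
      by (intro Bochner_Integration.integral_cong) (auto simp: w_def)
    also have "\<dots> = survival M Z q + c * m"
      by (subst Bochner_Integration.integral_add) (auto simp: survival_def m_def less_top[symmetric])
    finally show ?thesis using cm by simp
  qed
  have int_Z: "integrable M Z" using bounded_rv_integrable[OF Z] .
  have "tail_mean M p Z \<le> p * q + (\<integral>\<omega>. max 0 (Z \<omega> - q) \<partial>M)" by (rule tail_mean_le[OF Z p01])
  also have "\<dots> = (\<integral>\<omega>. q * w \<omega> + max 0 (Z \<omega> - q) \<partial>M)"
    using int_w bounded_rv_integrable_excess[OF Z] by (simp add: Ew)
  also have "\<dots> = (\<integral>\<omega>. w \<omega> * Z \<omega> \<partial>M)"
    by (intro Bochner_Integration.integral_cong) (auto simp: w_def)
  finally have "tail_mean M p Z - (\<integral>\<omega>. max 0 (Z \<omega> - k) \<partial>M)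
      \<le> (\<integral>\<omega>. w \<omega> * Z \<omega> - max 0 (Z \<omega> - k) \<partial>M)"
    using int_wf[OF int_Z] bounded_rv_integrable_excess[OF Z] by simp
  also have "\<dots> \<le> (\<integral>\<omega>. k * w \<omega> - w \<omega> * max 0 ((k - Y \<omega>) - X \<omega>) \<partial>M)"
  proof (rule integral_mono)
    have "integrable M (\<lambda>\<omega>. max 0 ((k - Y \<omega>) - X \<omega>))"
      using bounded_rv_integrable[OF X] bounded_rv_integrable[OF Y]
      by (intro Bochner_Integration.integrable_max Bochner_Integration.integrable_diff) auto
    then show "integrable M (\<lambda>\<omega>. k * w \<omega> - w \<omega> * max 0 ((k - Y \<omega>) - X \<omega>))"
      using int_w int_wf by auto
    show "w \<omega> * Z \<omega> - max 0 (Z \<omega> - k) \<le> k * w \<omega> - w \<omega> * max 0 ((k - Y \<omega>) - X \<omega>)" for \<omega>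
    proof (cases "k \<le> Z \<omega>")
      case True
      have "w \<omega> * (Z \<omega> - k) \<le> 1 * (Z \<omega> - k)" using True w01[of \<omega>] by (intro mult_right_mono) auto
      then show ?thesis using True by (simp add: Z_def algebra_simps)
    next
      case False
      then show ?thesis by (simp add: Z_def algebra_simps)
    qed
  qed (use int_wf[OF int_Z] bounded_rv_integrable_excess[OF Z] in auto)
  also have "\<dots> = p * k - (\<integral>\<omega>. w \<omega> * max 0 ((k - Y \<omega>) - X \<omega>) \<partial>M)"
  proof -
    have "integrable M (\<lambda>\<omega>. max 0 ((k - Y \<omega>) - X \<omega>))"
      using bounded_rv_integrable[OF X] bounded_rv_integrable[OF Y]
      by (intro Bochner_Integration.integrable_max Bochner_Integration.integrable_diff) auto
    then show ?thesis using int_w int_wf by (simp add: Ew)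
  qed
  also have "\<dots> \<le> p * k - (\<integral>s. tail_gap p k X Y s \<partial>lborel)"
  proof -
    have bd: "bounded_rv (L + \<bar>k\<bar>) X" "bounded_rv (L + \<bar>k\<bar>) (\<lambda>\<omega>. k - Y \<omega>)"
      using X Y by (force simp: abs_le_iff)+
    note between = integral_weight_between[OF bd wm w01]
    have ind: "integrable M (indicator {\<omega> \<in> space M. x < V \<omega>} :: 'a \<Rightarrow> real)"
      if [measurable]: "V \<in> borel_measurable M" for V and x :: real
      by (intro integrable_real_indicator) (measurable, simp add: less_top[symmetric])
    \<comment> \<open>A tail event carries at most the total weight \<open>p\<close> and at most its
      own probability. Removing two such events leaves at least the Frechet bound in
      \<open>tail_gap\<close>.\<close>
    have excl: "(\<integral>\<omega>. w \<omega> * indicator {\<omega> \<in> space M. x < V \<omega>} \<omega> \<partial>M) \<le> min p (survival M V x)"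
      if [measurable]: "V \<in> borel_measurable M" for V x
    proof -
      have "(\<integral>\<omega>. w \<omega> * indicator {\<omega> \<in> space M. x < V \<omega>} \<omega> \<partial>M) \<le> (\<integral>\<omega>. w \<omega> \<partial>M)"
        using w01 by (intro integral_mono int_wf[OF ind[OF that]] int_w) (auto simp: indicator_def)
      moreover have "(\<integral>\<omega>. w \<omega> * indicator {\<omega> \<in> space M. x < V \<omega>} \<omega> \<partial>M)
          \<le> (\<integral>\<omega>. indicator {\<omega> \<in> space M. x < V \<omega>} \<omega> \<partial>M)"
        using w01 by (intro integral_mono int_wf[OF ind[OF that]] ind that) (auto simp: indicator_def)
      ultimately show ?thesis using Ew by (simp add: survival_def)
    qed
    have "tail_gap p k X Y s \<le> (\<integral>\<omega>. w \<omega> * (if X \<omega> \<le> s \<and> s \<le> k - Y \<omega> then 1 else 0) \<partial>M)" for s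
    proof -
      let ?f = "\<lambda>\<omega>. w \<omega> * (if X \<omega> \<le> s \<and> s \<le> k - Y \<omega> then 1 else 0 :: real)"
      let ?A = "{\<omega> \<in> space M. s < X \<omega>}" and ?B = "{\<omega> \<in> space M. k - s < Y \<omega>}"
      have int_f: "integrable M ?f" by (intro int_wf integrable_const_bound[of _ 1]) auto
      have "0 \<le> (\<integral>\<omega>. ?f \<omega> \<partial>M)" using w01 by (intro integral_nonneg_AE) auto
      moreover have "(\<integral>\<omega>. w \<omega> - w \<omega> * indicator ?A \<omega> - w \<omega> * indicator ?B \<omega> \<partial>M) \<le> (\<integral>\<omega>. ?f \<omega> \<partial>M)"
        using w01 by (intro integral_mono int_f Bochner_Integration.integrable_diff int_w int_wf ind)
          (auto simp: indicator_def)
      moreover have "(\<integral>\<omega>. w \<omega> - w \<omega> * indicator ?A \<omega> - w \<omega> * indicator ?B \<omega> \<partial>M)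
          = p - (\<integral>\<omega>. w \<omega> * indicator ?A \<omega> \<partial>M) - (\<integral>\<omega>. w \<omega> * indicator ?B \<omega> \<partial>M)"
        using Ew int_w int_wf[OF ind[of X s]] int_wf[OF ind[of Y "k - s"]] by simp
      ultimately show ?thesis
        using excl[of X s] excl[of Y "k - s"] unfolding tail_gap_def by (simp add: max_def)
    qed
    then have "(\<integral>s. tail_gap p k X Y s \<partial>lborel) \<le> (\<integral>\<omega>. w \<omega> * max 0 ((k - Y \<omega>) - X \<omega>) \<partial>M)"
      unfolding between(2)[symmetric]
      by (intro integral_mono between(1) integrable_tail_gap[OF X Y p])
    then show ?thesis by simp
  qed
  finally show ?thesis unfolding Z_def .
qed

text \<open>The counterpart under \<open>C\<close> of the upper estimate
  \<open>tail_mean_diff_excess_le\<close>: the tail mean at \<open>p\<close> is superadditive, the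
  one at \<open>a\<close> is bounded variationally at \<open>k\<close>, and the integrands differ
  exactly by \<open>tail_gap\<close>.\<close>

lemma C_pm_tail_mean_diff_ge:
  assumes X: "bounded_rv L X" and Y: "bounded_rv L Y" and C: "copula_of M C X Y"
    and C_pm: "\<forall>u\<in>{0..1}. \<forall>v\<in>{0..1}. C u v = C_pm p u v" and p: "p \<in> {0<..<1}" and a: "a \<in> {0..p}"
    and k: "\<And>s. survival M X s \<le> p \<or> survival M Y (k - s) \<le> p"
  shows "(p - a) * k - (\<integral>s. tail_gap p k X Y s \<partial>lborel)
    \<le> tail_mean M p (\<lambda>\<omega>. X \<omega> + Y \<omega>) - tail_mean M a (\<lambda>\<omega>. X \<omega> + Y \<omega>)"
proof -
  have p01: "p \<in> {0..1}" "a \<in> {0..1}" using p a by auto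
  have XY: "bounded_rv (2 * L) (\<lambda>\<omega>. X \<omega> + Y \<omega>)" by (rule bounded_rv_add[OF X Y])
  \<comment> \<open>If both survival probabilities exceeded \<open>p\<close>, the joint one,
    \<open>min x y\<close>, would exceed the capped expression, which is then \<open>p\<close>; the
    hypothesis on \<open>k\<close> excludes this.\<close>
  have pointwise: "- max 0 (max 0 (p - x) + max 0 (p - y) - p)
      = (min x p + min y p - p) - (x + y - 1 + C (1 - x) (1 - y))"
    if "0 \<le> x" "x \<le> 1" "0 \<le> y" "y \<le> 1" "x \<le> p \<or> y \<le> p" for x y
    using that C_pm[rule_format, of "1 - x" "1 - y"] p
    by (auto simp: C_pm_def min_def max_def split: if_splits)
  have "- (\<integral>s. tail_gap p k X Y s \<partial>lborel) = (\<integral>s. - tail_gap p k X Y s \<partial>lborel)" by simp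
  also have "\<dots> = (\<integral>s. (min (survival M X s) p + min (survival M Y (k - s)) p - p)
      - (survival M X s + survival M Y (k - s) - 1 + C (1 - survival M X s) (1 - survival M Y (k - s))) \<partial>lborel)"
    unfolding tail_gap_def by (intro Bochner_Integration.integral_cong refl pointwise survival_bounds k)
  also have "\<dots> = (tail_mean M p X + tail_mean M p Y - p * k) - (\<integral>\<omega>. max 0 (X \<omega> + Y \<omega> - k) \<partial>M)"
    unfolding tail_mean_add_eq_integral(2)[OF X Y p01(1)] integral_excess_add(2)[OF X Y C, symmetric]
    by (intro Bochner_Integration.integral_diff tail_mean_add_eq_integral(1)[OF X Y p01(1)]
        integral_excess_add(1)[OF X Y C])
  finally show ?thesis
    using C_pm_tail_mean_superadditive[OF X Y C C_pm p, of p] tail_mean_le[OF XY p01(2), of k] p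
    by (simp add: algebra_simps)
qed

text \<open>At an \<open>a\<close>-quantile \<open>k\<close> of the competing sum the upper estimate
  depends on the marginals only. It is matched under \<open>C\<close> at the same \<open>k\<close>,
  or at the sum of the \<open>p\<close>-quantiles of \<open>X\<close> and \<open>Y\<close> if that
  is larger.\<close>

lemma C_pm_tail_mean_diff_maximal:
  assumes X: "bounded_rv L X" and Y: "bounded_rv L Y" and X': "bounded_rv L X'" and Y': "bounded_rv L Y'"
    and C: "copula_of M C X Y"
    and C_pm: "\<forall>u\<in>{0..1}. \<forall>v\<in>{0..1}. C u v = C_pm p u v" and p: "p \<in> {0<..<1}" and a: "a \<in> {0..p}"
    and law: "survival M X' = survival M X" "survival M Y' = survival M Y"
  shows "tail_mean M p (\<lambda>\<omega>. X' \<omega> + Y' \<omega>) - tail_mean M a (\<lambda>\<omega>. X' \<omega> + Y' \<omega>)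
    \<le> tail_mean M p (\<lambda>\<omega>. X \<omega> + Y \<omega>) - tail_mean M a (\<lambda>\<omega>. X \<omega> + Y \<omega>)"
proof -
  have p01: "p \<in> {0..1}" "a \<in> {0..1}" using p a by auto
  have Xm: "X \<in> borel_measurable M" "Y \<in> borel_measurable M" using X Y by auto
  have XY': "bounded_rv (2 * L) (\<lambda>\<omega>. X' \<omega> + Y' \<omega>)" by (rule bounded_rv_add[OF X' Y'])
  obtain k where k: "survival M (\<lambda>\<omega>. X' \<omega> + Y' \<omega>) k \<le> a" "a \<le> prob {\<omega> \<in> space M. k \<le> X' \<omega> + Y' \<omega>}"
    using quantile_exists[OF XY' p01(2)] .
  obtain x where x: "survival M X x \<le> p" "p \<le> prob {\<omega> \<in> space M. x \<le> X \<omega>}"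
    using quantile_exists[OF X p01(1)] .
  obtain y where y: "survival M Y y \<le> p" "p \<le> prob {\<omega> \<in> space M. y \<le> Y \<omega>}"
    using quantile_exists[OF Y p01(1)] .
  have gap: "tail_gap p k X' Y' = tail_gap p k X Y" by (simp add: tail_gap_def law fun_eq_iff)
  have upper: "tail_mean M p (\<lambda>\<omega>. X' \<omega> + Y' \<omega>) - tail_mean M a (\<lambda>\<omega>. X' \<omega> + Y' \<omega>)
      \<le> (p - a) * k - (\<integral>s. tail_gap p k X Y s \<partial>lborel)"
    using tail_mean_diff_excess_le[OF X' Y' p, of k] tail_mean_eq[OF XY' p01(2) k]
    by (simp add: gap algebra_simps)
  have above: "survival M X s \<le> p \<or> survival M Y (l - s) \<le> p" if "x + y \<le> l" for l s
  proof (cases "x \<le> s")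
    case True
    then show ?thesis using survival_antimono[OF Xm(1) True] x(1) by simp
  next
    case False
    then have "y \<le> l - s" using that by simp
    then show ?thesis using survival_antimono[OF Xm(2), of y "l - s"] y(1) by simp
  qed
  show ?thesis
  proof (cases "x + y \<le> k")
    case True
    then show ?thesis using C_pm_tail_mean_diff_ge[OF X Y C C_pm p a above[OF True]] upper by linarith
  next
    case False
    \<comment> \<open>For small \<open>k\<close> the lower estimate is applied at
      \<open>x + y\<close> instead: there the gap vanishes almost everywhere, since one of the
      survival probabilities is at least \<open>p\<close>, and \<open>(p - a) * k\<close> only
      grows.\<close>
    have "AE s in lborel. tail_gap p (x + y) X Y s = 0"
      using AE_lborel_singleton[of x]
    proof eventually_elim
      case (elim s)
      then consider "s < x" | "x + y - s < y" by linarith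
      then show ?case
      proof cases
        case 1
        then have "p \<le> survival M X s" using survival_ge_below[OF Xm(1)] x(2) by force
        then show ?thesis using p survival_bounds(1)[of Y "x + y - s"] by (auto simp: tail_gap_def max_def)
      next
        case 2
        then have "p \<le> survival M Y (x + y - s)" using survival_ge_below[OF Xm(2) 2] y(2) by simp
        then show ?thesis using p survival_bounds(1)[of X s] by (auto simp: tail_gap_def max_def)
      qed
    qed
    then have gap0: "(\<integral>s. tail_gap p (x + y) X Y s \<partial>lborel) = 0" by (rule integral_eq_zero_AE)
    have "0 \<le> (\<integral>s. tail_gap p k X Y s \<partial>lborel)"
      by (intro integral_nonneg_AE) (auto simp: tail_gap_def)
    moreover have "(p - a) * k \<le> (p - a) * (x + y)" using False a by (intro mult_left_mono) auto
    ultimately show ?thesis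
      using C_pm_tail_mean_diff_ge[OF X Y C C_pm p a above[of "x + y"]] gap0 upper by simp
  qed
qed

section \<open>From tail means to distorted expectations\<close>

lemma distorted_expectation_eq_integral:
  assumes Z: "bounded_rv L Z" and h: "distortion_function h"
  shows "integrable lborel (\<lambda>x. h (survival M Z x) - indicator {..<0} x)"
    and "distorted_expectation M h Z = (\<integral>x. h (survival M Z x) - indicator {..<0} x \<partial>lborel)"
proof -
  have Zm: "Z \<in> borel_measurable M" using Z by simp
  have h0: "h 0 = 0" "h 1 = 1" and hm: "mono_on {0..1} h" and h01: "\<And>t. t \<in> {0..1} \<Longrightarrow> h t \<in> {0..1}"
    using h by (auto simp: distortion_function_def)
  have L: "0 \<le> L" using Z not_empty by (auto intro: order_trans[OF abs_ge_zero])
  have "(\<lambda>x. - h (survival M Z x)) \<in> borel_measurable borel"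
    using survival_antimono[OF Zm] survival_bounds
    by (intro borel_measurable_mono monoI) (auto intro!: mono_onD[OF hm])
  then have "(\<lambda>x. - (- h (survival M Z x))) \<in> borel_measurable borel" by (rule borel_measurable_uminus)
  then have meas [measurable]: "(\<lambda>x. h (survival M Z x)) \<in> borel_measurable borel" by simp
  have hS: "h (survival M Z x) \<in> {0..1}" for x using survival_bounds[of Z x] by (intro h01) auto
  have pos: "integrable lborel (\<lambda>x. indicator {0..} x * h (survival M Z x))"
  proof (rule integrable_lborel_bounded_support[of _ 1 L])
    show "indicator {0..} x * h (survival M Z x) = 0" if "x \<notin> {-L..L}" for x
      using that survival_eq_0[OF Z, of x] h0 L by (cases "0 \<le> x") auto
  qed (use hS in \<open>auto simp: indicator_def\<close>)
  have neg: "integrable lborel (\<lambda>x. indicator {..0} x * (h (survival M Z x) - 1))"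
  proof (rule integrable_lborel_bounded_support[of _ 1 L])
    show "indicator {..0} x * (h (survival M Z x) - 1) = 0" if "x \<notin> {-L..L}" for x
      using that survival_eq_1[OF Z, of x] h0 L by (cases "x \<le> 0") auto
  qed (use hS in \<open>auto simp: indicator_def\<close>)
  have AE: "AE x in lborel. indicator {0..} x * h (survival M Z x)
      + indicator {..0} x * (h (survival M Z x) - 1) = h (survival M Z x) - indicator {..<0} x"
    using AE_lborel_singleton[of "0::real"] by eventually_elim (auto simp: indicator_def)
  show "integrable lborel (\<lambda>x. h (survival M Z x) - indicator {..<0} x)"
    by (rule integrable_cong_AE_imp[OF Bochner_Integration.integrable_add[OF pos neg] _ AE]) measurable
  have "distorted_expectation M h Z = (\<integral>x. indicator {0..} x * h (survival M Z x) \<partial>lborel)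
      + (\<integral>x. indicator {..0} x * (h (survival M Z x) - 1) \<partial>lborel)"
    by (simp add: distorted_expectation_def set_lebesgue_integral_def survival_def)
  also have "\<dots> = (\<integral>x. indicator {0..} x * h (survival M Z x)
      + indicator {..0} x * (h (survival M Z x) - 1) \<partial>lborel)"
    using pos neg by simp
  also have "\<dots> = (\<integral>x. h (survival M Z x) - indicator {..<0} x \<partial>lborel)"
    by (rule integral_cong_AE[OF _ _ AE]) measurable
  finally show "distorted_expectation M h Z = (\<integral>x. h (survival M Z x) - indicator {..<0} x \<partial>lborel)" .
qed

text \<open>The approximants \<open>H\<close> from \<open>S_shaped_approx\<close> turn the distorted
  expectation into nonnegative combinations \<open>E\<close> of the quantities compared in
  \<open>body\<close> and \<open>tail\<close>; the error is uniform because the integrands agree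
  outside \<open>[-L, L]\<close>.\<close>

lemma distorted_expectation_le_if_tail_mean_le:
  assumes Z: "bounded_rv L Z" and Z': "bounded_rv L Z'" and h: "S_shaped h p"
    and slopes: "\<forall>s\<in>{p<..1}. \<forall>t\<in>{0<..p}. (h s - h p) / (s - p) \<le> (h t - h 0) / (t - 0)"
    and body: "\<And>\<alpha>. \<alpha> \<in> {p..1} \<Longrightarrow> tail_mean M \<alpha> Z' \<le> tail_mean M \<alpha> Z"
    and tail: "\<And>a. a \<in> {0..p} \<Longrightarrow> tail_mean M p Z' - tail_mean M a Z' \<le> tail_mean M p Z - tail_mean M a Z"
  shows "distorted_expectation M h Z' \<le> distorted_expectation M h Z"
proof (rule field_le_epsilon)
  fix \<epsilon> :: real assume "0 < \<epsilon>"
  have h': "distortion_function h" and p: "0 < p" "p < 1" and h1: "h 1 = 1"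
    using h by (auto simp: S_shaped_def distortion_function_def)
  have L: "0 \<le> L" using Z not_empty by (auto intro: order_trans[OF abs_ge_zero])
  \<comment> \<open>Replacing \<open>h\<close> by \<open>H\<close> costs \<open>2 * \<delta>\<close>
    on an interval of length \<open>2 * L\<close>, once for each of \<open>Z\<close> and
    \<open>Z'\<close>; \<open>L + 1\<close> avoids a zero denominator.\<close>
  define \<delta> where "\<delta> = \<epsilon> / (8 * (L + 1))"
  have \<delta>: "0 < \<delta>" "8 * (L * \<delta>) \<le> \<epsilon>" using \<open>0 < \<epsilon>\<close> L by (auto simp: \<delta>_def field_simps)
  obtain n m :: nat and a b c e :: "nat \<Rightarrow> real" and r
    where c: "\<And>k. k < n \<Longrightarrow> 0 \<le> c k \<and> a k \<in> {0..p}" and e: "\<And>k. k < m \<Longrightarrow> 0 \<le> e k \<and> b k \<in> {p..1}" and r: "0 \<le> r"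
    and approx: "\<And>t. t \<in> {0..1} \<Longrightarrow> \<bar>h t - ((\<Sum>k<n. c k * (min t p - min t (a k))) +
       (\<Sum>k<m. e k * min t (b k)) + r * min t p)\<bar> \<le> \<delta>"
    by (rule S_shaped_approx[OF h \<delta>(1) slopes]) (blast intro: that)
  define H where "H t = (\<Sum>k<n. c k * (min t p - min t (a k))) + (\<Sum>k<m. e k * min t (b k)) + r * min t p" for t
  \<comment> \<open>\<open>H 1\<close> may differ from 1; subtracting it instead of 1 keeps the
    integrand zero below \<open>-L\<close>.\<close>
  define E where "E V = (\<integral>x. H (survival M V x) - H 1 * indicator {..<0} x \<partial>lborel)" for V
  define f where "f V \<alpha> x = min (survival M V x) \<alpha> - \<alpha> * indicator {..<0} x" for V \<alpha> and x :: real
  have E: "E V = (\<Sum>k<n. c k * (tail_mean M p V - tail_mean M (a k) V)) + (\<Sum>k<m. e k * tail_mean M (b k) V)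
        + r * tail_mean M p V"
    and int_E: "integrable lborel (\<lambda>x. H (survival M V x) - H 1 * indicator {..<0} x)"
    if V: "bounded_rv L V" for V
  proof -
    have int: "integrable lborel (f V \<alpha>)" and tm: "(\<integral>x. f V \<alpha> x \<partial>lborel) = tail_mean M \<alpha> V"
      if "\<alpha> \<in> {0..1}" for \<alpha>
      using integrable_tail_mean[OF V that] unfolding f_def tail_mean_def by auto
    have ab: "a k \<in> {0..1}" if "k < n" for k using c[OF that] p by auto
    have bb: "b k \<in> {0..1}" if "k < m" for k using e[OF that] p by auto
    have pp: "p \<in> {0..1}" using p by auto
    have "min 1 (a k) = a k" if "k < n" for k using ab[OF that] by simp
    moreover have "min 1 (b k) = b k" if "k < m" for k using bb[OF that] by simp
    ultimately have H1: "H 1 = (\<Sum>k<n. c k * (p - a k)) + (\<Sum>k<m. e k * b k) + r * p"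
      unfolding H_def using p by (intro arg_cong2[where f = "(+)"] sum.cong) auto
    have eq: "H (survival M V x) - H 1 * indicator {..<0} x
      = (\<Sum>k<n. c k * (f V p x - f V (a k) x)) + (\<Sum>k<m. e k * f V (b k) x) + r * f V p x" for x
      unfolding H1 unfolding f_def H_def
      by (simp add: algebra_simps sum.distrib sum_subtractf sum_distrib_left sum_distrib_right)
    show "integrable lborel (\<lambda>x. H (survival M V x) - H 1 * indicator {..<0} x)"
      unfolding eq using ab bb pp
      by (intro Bochner_Integration.integrable_add Bochner_Integration.integrable_sum
          integrable_mult_right Bochner_Integration.integrable_diff int) auto
    have i1: "integrable lborel (\<lambda>x. c k * (f V p x - f V (a k) x))" if "k < n" for k
      using ab[OF that] pp by (intro integrable_mult_right Bochner_Integration.integrable_diff int)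
    have i2: "integrable lborel (\<lambda>x. e k * f V (b k) x)" if "k < m" for k
      using bb[OF that] by (intro integrable_mult_right int)
    have i12: "integrable lborel (\<lambda>x. \<Sum>k<n. c k * (f V p x - f V (a k) x))"
      "integrable lborel (\<lambda>x. \<Sum>k<m. e k * f V (b k) x)"
      using i1 i2 by (intro Bochner_Integration.integrable_sum; simp only: lessThan_iff)+
    have i3: "integrable lborel (\<lambda>x. r * f V p x)" by (intro integrable_mult_right int pp)
    have "E V = (\<integral>x. (\<Sum>k<n. c k * (f V p x - f V (a k) x)) \<partial>lborel)
        + (\<integral>x. (\<Sum>k<m. e k * f V (b k) x) \<partial>lborel) + (\<integral>x. r * f V p x \<partial>lborel)"
      unfolding E_def eq
      by (simp only: Bochner_Integration.integral_add[OF Bochner_Integration.integrable_add[OF i12] i3]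
          Bochner_Integration.integral_add[OF i12])
    also have "(\<integral>x. (\<Sum>k<n. c k * (f V p x - f V (a k) x)) \<partial>lborel)
        = (\<Sum>k<n. c k * (tail_mean M p V - tail_mean M (a k) V))"
      using i1 int ab pp by (subst Bochner_Integration.integral_sum) (auto simp: tm)
    also have "(\<integral>x. (\<Sum>k<m. e k * f V (b k) x) \<partial>lborel) = (\<Sum>k<m. e k * tail_mean M (b k) V)"
      using i2 int bb by (subst Bochner_Integration.integral_sum) (auto simp: tm)
    also have "(\<integral>x. r * f V p x \<partial>lborel) = r * tail_mean M p V" using pp by (simp add: tm)
    finally show "E V = (\<Sum>k<n. c k * (tail_mean M p V - tail_mean M (a k) V))
        + (\<Sum>k<m. e k * tail_mean M (b k) V) + r * tail_mean M p V" .
  qed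
  have close: "\<bar>distorted_expectation M h V - E V\<bar> \<le> 4 * (L * \<delta>)" if V: "bounded_rv L V" for V
  proof -
    note dV = distorted_expectation_eq_integral[OF V h']
    have "\<bar>distorted_expectation M h V - E V\<bar>
      = \<bar>\<integral>x. (h (survival M V x) - indicator {..<0} x) - (H (survival M V x) - H 1 * indicator {..<0} x) \<partial>lborel\<bar>"
      unfolding dV(2) E_def using dV(1) int_E[OF V] by simp
    also have "\<dots> \<le> (\<integral>x. 2 * \<delta> * indicator {-L..L} x \<partial>lborel)"
    proof (rule integral_abs_bound_integral)
      fix x :: real
      have "\<bar>h (survival M V x) - H (survival M V x)\<bar> \<le> \<delta>"
        unfolding H_def using survival_bounds[of V x] by (intro approx) auto
      moreover have "\<bar>h 1 - H 1\<bar> \<le> \<delta>" unfolding H_def by (intro approx) auto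
      moreover have "H 0 = 0" unfolding H_def using c e p by (force simp: min_def intro!: sum.neutral)
      moreover have "h 0 = 0" using h' by (simp add: distortion_function_def)
      ultimately show "\<bar>(h (survival M V x) - indicator {..<0} x)
          - (H (survival M V x) - H 1 * indicator {..<0} x)\<bar> \<le> 2 * \<delta> * indicator {-L..L} x"
        using survival_eq_1[OF V, of x] survival_eq_0[OF V, of x] L h1
        by (auto simp: indicator_def)
    qed (auto intro!: dV(1) int_E[OF V] Bochner_Integration.integrable_diff
      integrable_mult_right integrable_real_indicator simp: emeasure_lborel_Icc_eq)
    also have "\<dots> = 4 * (L * \<delta>)" using L by simp
    finally show ?thesis .
  qed
  have "E Z' \<le> E Z"
    unfolding E[OF Z] E[OF Z'] using c e r body tail p
    by (intro add_mono sum_mono mult_left_mono) auto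
  then show "distorted_expectation M h Z' \<le> distorted_expectation M h Z + \<epsilon>"
    using close[OF Z] close[OF Z'] \<delta>(2) by linarith
qed

lemma C_pm_universally_maximal:
  assumes h: "S_shaped h p" and C_pm: "\<forall>u\<in>{0..1}. \<forall>v\<in>{0..1}. C u v = C_pm p u v"
    and slopes: "\<forall>s\<in>{p<..1}. \<forall>t\<in>{0<..p}. (h s - h p) / (s - p) \<le> (h t - h 0) / (t - 0)"
  shows "universally_maximal M h C"
  unfolding universally_maximal_def
proof (intro ballI impI)
  fix X Y X' Y'
  assume rv: "X \<in> bounded_rvs M" "Y \<in> bounded_rvs M" "X' \<in> bounded_rvs M" "Y' \<in> bounded_rvs M"
    and C: "copula_of M C X Y" and law: "eq_in_law M X' X" "eq_in_law M Y' Y"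
  have p: "p \<in> {0<..<1}" using h by (simp add: S_shaped_def)
  have m: "X \<in> borel_measurable M" "Y \<in> borel_measurable M" "X' \<in> borel_measurable M" "Y' \<in> borel_measurable M"
    using rv by (auto simp: bounded_rvs_def)
  have "bounded (X ` space M \<union> Y ` space M \<union> X' ` space M \<union> Y' ` space M)"
    using rv by (auto simp: bounded_rvs_def)
  then obtain L where L: "\<forall>x \<in> X ` space M \<union> Y ` space M \<union> X' ` space M \<union> Y' ` space M. \<bar>x\<bar> \<le> L"
    unfolding bounded_iff real_norm_def ..
  have bd: "bounded_rv L X" "bounded_rv L Y" "bounded_rv L X'" "bounded_rv L Y'"
    by (intro conjI ballI m L[rule_format]; simp)+
  note bdZ = bounded_rv_add[OF bd(1,2)] bounded_rv_add[OF bd(3,4)]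
  have surv: "survival M X' = survival M X" "survival M Y' = survival M Y"
    using eq_in_law_survival law m by auto
  then have tm: "tail_mean M \<alpha> X' = tail_mean M \<alpha> X" "tail_mean M \<alpha> Y' = tail_mean M \<alpha> Y" for \<alpha>
    by (simp_all add: tail_mean_def)
  show "distorted_expectation M h (\<lambda>\<omega>. X' \<omega> + Y' \<omega>) \<le> distorted_expectation M h (\<lambda>\<omega>. X \<omega> + Y \<omega>)"
  proof (rule distorted_expectation_le_if_tail_mean_le[OF bdZ h slopes])
    fix \<alpha> assume \<alpha>: "\<alpha> \<in> {p..1}"
    then have "\<alpha> \<in> {0..1}" using p by auto
    then have "tail_mean M \<alpha> (\<lambda>\<omega>. X' \<omega> + Y' \<omega>) \<le> tail_mean M \<alpha> X + tail_mean M \<alpha> Y"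
      using tail_mean_subadditive[OF bd(3,4)] by (simp add: tm)
    also have "\<dots> \<le> tail_mean M \<alpha> (\<lambda>\<omega>. X \<omega> + Y \<omega>)"
      by (rule C_pm_tail_mean_superadditive[OF bd(1,2) C C_pm p \<alpha>])
    finally show "tail_mean M \<alpha> (\<lambda>\<omega>. X' \<omega> + Y' \<omega>) \<le> tail_mean M \<alpha> (\<lambda>\<omega>. X \<omega> + Y \<omega>)" .
  qed (rule C_pm_tail_mean_diff_maximal[OF bd C C_pm p _ surv])
qed

end

section \<open>The derivative condition and the equivalence\<close>

text \<open>The derivative at \<open>p\<close> is the supremum of the chord slopes to its right, the
  one at 0 the infimum of those up to \<open>p\<close>. Both directions work with the resulting
  comparison of real slopes, which also covers an infinite derivative at \<open>p\<close>.\<close>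

lemma S_shaped_right_deriv_le_iff:
  assumes "S_shaped h p"
  shows "right_deriv h p \<le> right_deriv h 0 \<longleftrightarrow>
    (\<forall>s\<in>{p<..1}. \<forall>t\<in>{0<..p}. (h s - h p) / (s - p) \<le> (h t - h 0) / (t - 0))"
proof -
  have p: "0 < p" "p < 1" and cont: "continuous_on {0..1} h"
    and cc: "convex_on {0<..<p} h" "convex_on {p<..<1} (\<lambda>x. - h x)"
    using assms by (auto simp: S_shaped_def concave_on_def)
  have cont1: "continuous_on {0..p} h" and cont2: "continuous_on {p..1} (\<lambda>x. - h x)"
    using p by (auto intro!: continuous_intros continuous_on_subset[OF cont])
  have "concave_on {p..1} h"
    unfolding concave_on_def by (rule convex_on_Icc_if_convex_on_Ioo[OF cont2 cc(2)])
  then show ?thesis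
    by (simp only: right_deriv_concave[OF _ p(2)] SUP_ereal_le_INF_ereal_iff
        right_deriv_convex[OF convex_on_Icc_if_convex_on_Ioo[OF cont1 cc(1)] p(1)])
qed

theorem theorem5:
  fixes M :: "'a measure" and h :: "real \<Rightarrow> real" and p :: real
    and C :: "real \<Rightarrow> real \<Rightarrow> real"
  assumes "prob_space M" and "atomless M"
    and "S_shaped h p" and "is_copula C"
  shows "((\<forall>u\<in>{0..1}. \<forall>v\<in>{0..1}. C u v = C_pm p u v) \<and> right_deriv h p \<le> right_deriv h 0
            \<longrightarrow> universally_maximal M h C) \<and>
         (strictly_S_shaped h p \<longrightarrow>
           ((\<forall>u\<in>{0..1}. \<forall>v\<in>{0..1}. C u v = C_pm p u v) \<and> right_deriv h p \<le> right_deriv h 0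
             \<longleftrightarrow> universally_maximal M h C))"
proof -
  interpret prob_space M by fact
  have h01: "h 0 = 0" "h 1 = 1" using assms(3) by (auto simp: S_shaped_def distortion_function_def)
  note deriv_iff = S_shaped_right_deriv_le_iff[OF assms(3)]
  have suff: "universally_maximal M h C"
    if "(\<forall>u\<in>{0..1}. \<forall>v\<in>{0..1}. C u v = C_pm p u v) \<and> right_deriv h p \<le> right_deriv h 0"
    using that C_pm_universally_maximal[OF assms(3)] unfolding deriv_iff by blast
  moreover have "(\<forall>u\<in>{0..1}. \<forall>v\<in>{0..1}. C u v = C_pm p u v) \<and> right_deriv h p \<le> right_deriv h 0"
    if strict: "strictly_S_shaped h p" and max: "universally_maximal M h C"
  proof -
    have overlap: "h \<gamma> + h (\<alpha> + \<beta> - \<gamma>)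
        \<le> h (\<alpha> + \<beta> - 1 + C (1 - \<alpha>) (1 - \<beta>)) + h (1 - C (1 - \<alpha>) (1 - \<beta>))"
      if "\<alpha> \<in> {0..1}" "\<beta> \<in> {0..1}" "0 \<le> \<gamma>" "\<alpha> + \<beta> - 1 \<le> \<gamma>" "\<gamma> \<le> \<alpha>" "\<gamma> \<le> \<beta>" for \<alpha> \<beta> \<gamma>
      using maximal_overlap[OF assms(2,4) max h01 that refl] by simp
    show ?thesis
      unfolding deriv_iff
      using strictly_S_shaped_overlap_imp_C_pm[OF strict assms(4) overlap] by blast
  qed
  ultimately show ?thesis by blast
qed

end
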